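(* Assume (H1)–(H7) of the context. Let $s\in[0,T[$, $x\in H$, and let $\widehat y=\widehat y(\cdot;s,x)$ be the optimal state of the problem of minimizing $J_s$ over $u\in L^2(s,T;U)$ with initial datum $x$ at time $s$. Let $P(\cdot)$ be the associated Riccati operator, with $P(T)=P_T$. Then $$t\mapsto P(t)^{1/2}\widehat y(t)\in C([s,T],H),$$ where the value at $t=T$ is $P_T^{1/2}\widehat y(T):=P_T^{1/2}U(T,s)x+P_T^{1/2}L_{sT}\widehat u$, $\widehat u$ being the optimal control.
   Context: Setting. $H,U$ are complex Hilbert spaces, $T>0$. $\Sigma^+(H)$ (resp. $\Sigma^+(U)$) is the set of bounded, selfadjoint, non-negative linear operators on $H$ (resp. $U$). $U(t,s)$ with two arguments denotes an evolution operator on $H$ (not the space $U$). (H1) For each $t\in[0,T]$, $A(t):D(A(t))\subseteq H\to H$ is a closed linear operator generating an analytic semigroup, $0\in\rho(A(t))$, and there are $M_0>0$, $\vartheta\in]\pi/2,\pi[$ with $\|(\lambda-A(t))^{-1}\|\le M_0(1+|\lambda|)^{-1}$ for all $\lambda\in\overline{S(\vartheta)}$, $t\in[0,T]$, where $S(\vartheta)=\{z\in\mathbb C:|\arg z|<\vartheta\}$. (H2) There are $N_0>0$ and $\rho,\mu\in]0,1]$ with $\delta:=\rho+\mu-1\in]0,\frac12[$ such that $\|A(t)[\lambda-A(t)]^{-1}[A(t)^{-1}-A(s)^{-1}]\|+\|A(t)^*[\lambda-A(t)^*]^{-1}[(A(t)^* )^{-1}-(A(s)^* )^{-1}]\|\le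 N_0|t-s|^\mu(1+|\lambda|)^{-\rho}$ for all $\lambda\in\overline{S(\vartheta)}$, $s,t\in[0,T]$. (H3) $\{U(t,s)\}_{0\le s\le t\le T}\subset\mathcal L(H)$ is the (strongly continuous) evolution operator of $\{A(t)\}$ ($U(t,t)=I$, $U(t,r)U(r,s)=U(t,s)$, $\partial_tU(t,s)=A(t)U(t,s)$ for $s<t$), and for $0\le s<t\le T$, $\eta,\gamma\in[0,1]$: $\|[-A(t)]^\eta U(t,s)[-A(s)]^{-\gamma}\|+\|[-A(s)^*]^\eta U(t,s)^*[-A(t)^*]^{-\gamma}\|\le M_{\eta\gamma}[1+(t-s)^{\gamma-\eta}]$. (H4) For $\eta,\gamma\in[0,1]$: $\|[-A(t)]^\eta U(t,s)[-A(s)]^{-\gamma}-[-A(\tau)]^\eta U(\tau,s)[-A(s)]^{-\gamma}\|\le N_{\eta\gamma}(t-\tau)^\delta[1+(\tau-s)^{\gamma-\eta-\delta}]$ for $0\le s<\tau\le t\le T$, and $\|[-A(\sigma)^*]^\eta U(t,\sigma)^*[-A(t)^*]^{-\gamma}-[-A(s)^*]^\eta U(t,s)^*[-A(t)^*]^{-\gamma}\|\le N_{\eta\gamma}(\sigma-s)^\delta[1+(t-\sigma)^{\gamma-\eta-\delta}]$ for $0\le s\le\sigma<t\le T$, all these operators being strongly continuous with respect to $t,\tau,\sigma,s$. (H5) $G(t)\in\mathcal L(U,H)$ for all $t\in[0,T]$, and there is $\alpha\in]\delta,\frac12[$ such that $t\mapsto[-A(t)]^\alpha G(t)\in C^\delta([0,T],\mathcal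 L(U,H))$. (H6) $M(\cdot)\in C^\delta([0,T],\Sigma^+(H))$, $N(\cdot)\in C^\delta([0,T],\Sigma^+(U))$, and there is $\nu>0$ with $\langle N(t)u,u\rangle_U\ge\nu\|u\|_U^2$ for all $t\in[0,T]$, $u\in U$. (H7) $P_T\in\Sigma^+(H)$ and the operator $P_T^{1/2}L_{0T}:D(L_{0T})\subseteq L^2(0,T;U)\to H$ is closed, where for $0\le s<T$: $D(L_{sT})=\{u\in L^2(s,T;U):\int_s^TA(T)^{-1}U(T,r)A(r)G(r)u(r)\,dr\in D(A(T))\}$ and $L_{sT}u=-A(T)\int_s^TA(T)^{-1}U(T,r)A(r)G(r)u(r)\,dr$. Conventions. $U(t,s)A(s)G(s):=-\big[[-A(s)^*]^{1-\alpha}U(t,s)^*\big]^*[-A(s)]^\alpha G(s)$; for an operator $B$ with range in $D([-A(r)^*]^{1-\alpha})$, $G(r)^*A(r)^*B:=-\big([-A(r)]^\alpha G(r)\big)^*[-A(r)^*]^{1-\alpha}B$. Control problem. For $u\in L^2(s,T;U)$ the state is $y(t)=U(t,s)x+[L_su](t)$, $[L_su](t)=-\int_s^tU(t,r)A(r)G(r)u(r)\,dr$. The cost is $J_s(u)=\int_s^T\|M(r)^{1/2}y(r)\|_H^2dr+\int_s^T\|N(r)^{1/2}u(r)\|_U^2dr+\|P_T^{1/2}y(T)\|_H^2$ if $u\in D(L_{sT})$, with $P_T^{1/2}y(T):=P_T^{1/2}U(T,s)x+P_T^{1/2}L_{sT}u$, and $J_s(u)=+\infty$ if $u\in L^2(s,T;U)\setminus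 D(L_{sT})$. Known facts (earlier work of Acquistapace–Terreni) which fix the objects: for each $s\in[0,T[$, $x\in H$ there is a unique minimizer $\widehat u\in D(L_{sT})$ of $J_s$, with state $\widehat y\in C([s,T[,H)$; there is $P:[0,T[\to\Sigma^+(H)$ (the Riccati operator) with $\langle P(s)x,x\rangle_H=J_s(\widehat u)$ for all $s,x$; it satisfies $P\in L^\infty(0,T;\Sigma^+(H))\cap C([0,T[,\Sigma^+(H))$, $P(t)x\to P_Tx$ as $t\to T^-$ for all $x\in H$, $\|[-A(t)^*]^{1-\alpha}P(t)\|\le c(T-t)^{\alpha-1}$ on $[0,T[$, it solves the integral Riccati equation $P(t)=U(T,t)^*P_TU(T,t)+\int_t^TU(r,t)^*[M(r)-P(r)A(r)G(r)N(r)^{-1}G(r)^*A(r)^*P(r)]U(r,t)\,dr$, and $\widehat u(t)=N(t)^{-1}G(t)^*A(t)^*P(t)\widehat y(t)$ for $t\in[s,T[$. *)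

theory Defs
  imports "HOL-Analysis.Analysis"
begin

section \<open>Complex Hilbert spaces\<close>

text \<open>The inner product is linear in its first argument. Norm, topology and completeness are those
  of the underlying real Hilbert space, whose inner product is the real part of the complex one.\<close>

class complex_hilbert = real_inner + banach +
  fixes scaleC :: "complex \<Rightarrow> 'a \<Rightarrow> 'a"  (infixr \<open>*\<^sub>C\<close> 75)
    and cinner :: "'a \<Rightarrow> 'a \<Rightarrow> complex"
  assumes scaleC_add_right: "c *\<^sub>C (x + y) = c *\<^sub>C x + c *\<^sub>C y"
    and scaleC_add_left: "(c + d) *\<^sub>C x = c *\<^sub>C x + d *\<^sub>C x"
    and scaleC_scaleC: "c *\<^sub>C d *\<^sub>C x = (c * d) *\<^sub>C x"
    and scaleR_eq_scaleC: "r *\<^sub>R x = complex_of_real r *\<^sub>C x"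
    and cinner_commute: "cinner x y = cnj (cinner y x)"
    and cinner_add_left: "cinner (x + y) z = cinner x z + cinner y z"
    and cinner_scaleC_left: "cinner (c *\<^sub>C x) y = c * cinner x y"
    and inner_eq_Re_cinner: "inner x y = Re (cinner x y)"


section \<open>Linear operators\<close>

text \<open>A bounded operator is an element of the library type of bounded real-linear maps (whose norm
  is the operator norm) which is moreover complex linear.\<close>

definition clinear_op :: "('a::complex_hilbert \<Rightarrow>\<^sub>L 'b::complex_hilbert) \<Rightarrow> bool" where
  "clinear_op B \<longleftrightarrow> (\<forall>c x. B (c *\<^sub>C x) = c *\<^sub>C B x)"

definition Sigma_plus :: "('a::complex_hilbert \<Rightarrow>\<^sub>L 'a) set" where
  "Sigma_plus = {B. clinear_op B \<and> (\<forall>x y. cinner (B x) y = cinner x (B y))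
                    \<and> (\<forall>x. 0 \<le> Re (cinner (B x) x))}"

definition sqrt_op :: "('a::complex_hilbert \<Rightarrow>\<^sub>L 'a) \<Rightarrow> ('a \<Rightarrow>\<^sub>L 'a)" where
  "sqrt_op B = (THE S. S \<in> Sigma_plus \<and> S o\<^sub>L S = B)"

text \<open>Operators that need not be bounded or everywhere defined are represented by their graphs.
  The domain of \<open>R\<close> is then \<open>Domain R\<close>, the inverse is the converse relation, and the product
  \<open>B A\<close> (first \<open>A\<close>, then \<open>B\<close>, on its natural domain) is the relational composition \<open>A O B\<close>.\<close>

type_synonym ('a, 'b) oper = "('a \<times> 'b) set"

definition linear_oper :: "('a::complex_hilbert, 'b::complex_hilbert) oper \<Rightarrow> bool" where
  "linear_oper R \<longleftrightarrow> single_valued R \<and> (0, 0) \<in> R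
     \<and> (\<forall>x y x' y'. (x, y) \<in> R \<longrightarrow> (x', y') \<in> R \<longrightarrow> (x + x', y + y') \<in> R)
     \<and> (\<forall>c x y. (x, y) \<in> R \<longrightarrow> (c *\<^sub>C x, c *\<^sub>C y) \<in> R)"

definition closed_oper :: "('a::complex_hilbert, 'b::complex_hilbert) oper \<Rightarrow> bool" where
  "closed_oper R \<longleftrightarrow> linear_oper R \<and> closed R"

definition oper_apply :: "('a, 'b) oper \<Rightarrow> 'a \<Rightarrow> 'b" where
  "oper_apply R x = (THE y. (x, y) \<in> R)"

definition bgraph :: "('a::complex_hilbert \<Rightarrow>\<^sub>L 'b::complex_hilbert) \<Rightarrow> ('a, 'b) oper" where
  "bgraph B = range (\<lambda>x. (x, B x))"

definition bounded_oper :: "('a::complex_hilbert, 'b::complex_hilbert) oper \<Rightarrow> bool" where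
  "bounded_oper R \<longleftrightarrow> (\<exists>B. clinear_op B \<and> R = bgraph B)"

text \<open>The bounded operator with graph \<open>R\<close>; meaningful only if \<open>bounded_oper R\<close>.\<close>

definition bop :: "('a::complex_hilbert, 'b::complex_hilbert) oper \<Rightarrow> ('a \<Rightarrow>\<^sub>L 'b)" where
  "bop R = (THE B. R = bgraph B)"

definition oper_adj :: "('a::complex_hilbert, 'b::complex_hilbert) oper \<Rightarrow> ('b, 'a) oper" where
  "oper_adj R = {(y, z). \<forall>(x, w) \<in> R. cinner w y = cinner x z}"

definition badj :: "('a::complex_hilbert \<Rightarrow>\<^sub>L 'b::complex_hilbert) \<Rightarrow> ('b \<Rightarrow>\<^sub>L 'a)" where
  "badj B = bop (oper_adj (bgraph B))"

definition shifted :: "complex \<Rightarrow> ('a::complex_hilbert, 'a) oper \<Rightarrow> ('a, 'a) oper" where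
  "shifted l A = {(x, l *\<^sub>C x - y) | x y. (x, y) \<in> A}"

definition resolvent_set :: "('a::complex_hilbert, 'a) oper \<Rightarrow> complex set" where
  "resolvent_set A = {l. bounded_oper ((shifted l A)\<inverse>)}"

definition resolvent :: "('a::complex_hilbert, 'a) oper \<Rightarrow> complex \<Rightarrow> ('a \<Rightarrow>\<^sub>L 'a)" where
  "resolvent A l = bop ((shifted l A)\<inverse>)"

definition sector :: "real \<Rightarrow> complex set" where
  "sector \<theta> = {z. z \<noteq> 0 \<and> \<bar>Arg z\<bar> < \<theta>}"

text \<open>The bound \<open>\<phi> \<le> pi / 2\<close> makes the sector closed under addition.\<close>

definition generates_analytic_semigroup :: "('a::complex_hilbert, 'a) oper \<Rightarrow> bool" where
  "generates_analytic_semigroup A \<longleftrightarrow>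
     (\<exists>(S :: complex \<Rightarrow> 'a \<Rightarrow>\<^sub>L 'a) \<phi>. 0 < \<phi> \<and> \<phi> \<le> pi / 2
        \<and> S 0 = id_blinfun
        \<and> (\<forall>z \<in> sector \<phi>. clinear_op (S z))
        \<and> (\<forall>z \<in> sector \<phi>. \<forall>w \<in> sector \<phi>. S (z + w) = S z o\<^sub>L S w)
        \<and> (\<forall>z \<in> sector \<phi>. \<forall>x. \<exists>d. ((\<lambda>w. inverse (w - z) *\<^sub>C (S w x - S z x)) \<longlongrightarrow> d) (at z))
        \<and> (\<forall>x. ((\<lambda>z. S z x) \<longlongrightarrow> x) (at 0 within sector \<phi>))
        \<and> A = {(x, y). ((\<lambda>h. (1 / h) *\<^sub>R (S (complex_of_real h) x - x)) \<longlongrightarrow> y) (at_right 0)})"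

text \<open>\<open>neg_pow A \<gamma>\<close> is \<open>[-A]\<close> to the power \<open>-\<gamma>\<close> and \<open>pos_pow A \<eta>\<close> is \<open>[-A]\<close> to the power \<open>\<eta>\<close>,
  for exponents in \<open>[0,1]\<close>. For \<open>0 < \<gamma> < 1\<close> the negative power is the Balakrishnan integral
  \<open>sin (pi \<gamma>) / pi\<close> times the integral of \<open>l powr -\<gamma>\<close> times the resolvent \<open>(l - A)\<close> inverse
  over \<open>l > 0\<close>; positive powers are the inverses of the negative ones.\<close>

definition neg_pow :: "('a::complex_hilbert, 'a) oper \<Rightarrow> real \<Rightarrow> ('a, 'a) oper" where
  "neg_pow A \<gamma> =
     (if \<gamma> = 0 then Id
      else if \<gamma> = 1 then (shifted 0 A)\<inverse>
      else {(x, y). ((\<lambda>l. l powr (- \<gamma>) *\<^sub>R resolvent A (complex_of_real l) x)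
                       has_integral (pi / sin (pi * \<gamma>)) *\<^sub>R y) {0..}})"

definition pos_pow :: "('a::complex_hilbert, 'a) oper \<Rightarrow> real \<Rightarrow> ('a, 'a) oper" where
  "pos_pow A \<eta> = (neg_pow A \<eta>)\<inverse>"


section \<open>The space of square integrable functions and Hoelder continuity\<close>

text \<open>Elements of \<open>L2_space s T\<close> are representatives: only values on \<open>[s,T]\<close> up to null sets
  matter. The library predicate \<open>measurable_on\<close> (almost everywhere limit of continuous functions)
  is strong measurability, so the target space need not be separable. For the same reason
  vector-valued integrals are the library's gauge integrals, which agree with the Bochner integral
  on every Bochner integrable function.\<close>

definition L2_space :: "real \<Rightarrow> real \<Rightarrow> (real \<Rightarrow> 'u::complex_hilbert) set" where
  "L2_space s T = {u. u measurable_on {s..T}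
                     \<and> (\<integral>\<^sup>+ r \<in> {s..T}. ennreal ((norm (u r))\<^sup>2) \<partial>lebesgue) < \<infinity>}"

definition L2_tendsto ::
    "real \<Rightarrow> real \<Rightarrow> (nat \<Rightarrow> real \<Rightarrow> 'u::complex_hilbert) \<Rightarrow> (real \<Rightarrow> 'u) \<Rightarrow> bool" where
  "L2_tendsto s T v u \<longleftrightarrow>
     (\<lambda>n. \<integral>\<^sup>+ r \<in> {s..T}. ennreal ((norm (v n r - u r))\<^sup>2) \<partial>lebesgue) \<longlonglongrightarrow> 0"

definition holder_on :: "real \<Rightarrow> real \<Rightarrow> (real \<Rightarrow> 'b::real_normed_vector) \<Rightarrow> bool" where
  "holder_on T \<delta> f \<longleftrightarrow> (\<exists>C. \<forall>s \<in> {0..T}. \<forall>t \<in> {0..T}. norm (f t - f s) \<le> C * \<bar>t - s\<bar> powr \<delta>)"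


section \<open>The hypotheses on the operators\<close>

definition H1 :: "real \<Rightarrow> real \<Rightarrow> (real \<Rightarrow> ('h::complex_hilbert, 'h) oper) \<Rightarrow> bool" where
  "H1 T \<theta> A \<longleftrightarrow> pi / 2 < \<theta> \<and> \<theta> < pi
     \<and> (\<forall>t \<in> {0..T}. closed_oper (A t) \<and> generates_analytic_semigroup (A t)
                      \<and> 0 \<in> resolvent_set (A t))
     \<and> (\<exists>M0 > 0. \<forall>t \<in> {0..T}. \<forall>l \<in> closure (sector \<theta>).
          l \<in> resolvent_set (A t) \<and> norm (resolvent (A t) l) \<le> M0 / (1 + norm l))"

definition H2_op ::
    "('h::complex_hilbert, 'h) oper \<Rightarrow> ('h, 'h) oper \<Rightarrow> complex \<Rightarrow> ('h \<Rightarrow>\<^sub>L 'h)" where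
  "H2_op A B l = bop (bgraph (resolvent A l) O A) o\<^sub>L (bop (A\<inverse>) - bop (B\<inverse>))"

definition H2 ::
    "real \<Rightarrow> real \<Rightarrow> real \<Rightarrow> real \<Rightarrow> (real \<Rightarrow> ('h::complex_hilbert, 'h) oper) \<Rightarrow> bool" where
  "H2 T \<theta> \<rho> \<mu> A \<longleftrightarrow> 0 < \<rho> \<and> \<rho> \<le> 1 \<and> 0 < \<mu> \<and> \<mu> \<le> 1 \<and> 0 < \<rho> + \<mu> - 1 \<and> \<rho> + \<mu> - 1 < 1 / 2
     \<and> (\<exists>N0 > 0. \<forall>l \<in> closure (sector \<theta>). \<forall>s \<in> {0..T}. \<forall>t \<in> {0..T}.
          norm (H2_op (A t) (A s) l) + norm (H2_op (oper_adj (A t)) (oper_adj (A s)) l)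
            \<le> N0 * \<bar>t - s\<bar> powr \<mu> * (1 + norm l) powr (- \<rho>))"

text \<open>\<open>frac_evol A E \<eta> \<gamma> t s\<close> is \<open>[-A(t)]\<^sup>\<eta> E(t,s) [-A(s)]\<close> to the \<open>-\<gamma>\<close>, and
  \<open>frac_evol_adj A E \<eta> \<gamma> t s\<close> is \<open>[-A(s)*]\<^sup>\<eta> E(t,s)* [-A(t)*]\<close> to the \<open>-\<gamma>\<close>.\<close>

definition frac_evol ::
    "(real \<Rightarrow> ('h::complex_hilbert, 'h) oper) \<Rightarrow> (real \<Rightarrow> real \<Rightarrow> 'h \<Rightarrow>\<^sub>L 'h)
       \<Rightarrow> real \<Rightarrow> real \<Rightarrow> real \<Rightarrow> real \<Rightarrow> ('h, 'h) oper" where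
  "frac_evol A E \<eta> \<gamma> t s = neg_pow (A s) \<gamma> O bgraph (E t s) O pos_pow (A t) \<eta>"

definition frac_evol_adj ::
    "(real \<Rightarrow> ('h::complex_hilbert, 'h) oper) \<Rightarrow> (real \<Rightarrow> real \<Rightarrow> 'h \<Rightarrow>\<^sub>L 'h)
       \<Rightarrow> real \<Rightarrow> real \<Rightarrow> real \<Rightarrow> real \<Rightarrow> ('h, 'h) oper" where
  "frac_evol_adj A E \<eta> \<gamma> t s =
     neg_pow (oper_adj (A t)) \<gamma> O bgraph (badj (E t s)) O pos_pow (oper_adj (A s)) \<eta>"

definition evolution_operator ::
    "real \<Rightarrow> (real \<Rightarrow> ('h::complex_hilbert, 'h) oper) \<Rightarrow> (real \<Rightarrow> real \<Rightarrow> 'h \<Rightarrow>\<^sub>L 'h) \<Rightarrow> bool" where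
  "evolution_operator T A E \<longleftrightarrow>
     (\<forall>s t. 0 \<le> s \<and> s \<le> t \<and> t \<le> T \<longrightarrow> clinear_op (E t s))
     \<and> (\<forall>x. continuous_on {(t, s). 0 \<le> s \<and> s \<le> t \<and> t \<le> T} (\<lambda>(t, s). E t s x))
     \<and> (\<forall>t \<in> {0..T}. E t t = id_blinfun)
     \<and> (\<forall>s r t. 0 \<le> s \<and> s \<le> r \<and> r \<le> t \<and> t \<le> T \<longrightarrow> E t r o\<^sub>L E r s = E t s)
     \<and> (\<forall>s t x. 0 \<le> s \<and> s < t \<and> t \<le> T \<longrightarrow>
          (\<exists>y. (E t s x, y) \<in> A t
             \<and> ((\<lambda>\<tau>. E \<tau> s x) has_vector_derivative y) (at t within {s<..T})))"

definition H3 ::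
    "real \<Rightarrow> (real \<Rightarrow> ('h::complex_hilbert, 'h) oper) \<Rightarrow> (real \<Rightarrow> real \<Rightarrow> 'h \<Rightarrow>\<^sub>L 'h) \<Rightarrow> bool" where
  "H3 T A E \<longleftrightarrow> evolution_operator T A E
     \<and> (\<forall>\<eta> \<in> {0..1}. \<forall>\<gamma> \<in> {0..1}. \<exists>M. \<forall>s t. 0 \<le> s \<and> s < t \<and> t \<le> T \<longrightarrow>
          bounded_oper (frac_evol A E \<eta> \<gamma> t s) \<and> bounded_oper (frac_evol_adj A E \<eta> \<gamma> t s)
          \<and> norm (bop (frac_evol A E \<eta> \<gamma> t s)) + norm (bop (frac_evol_adj A E \<eta> \<gamma> t s))
              \<le> M * (1 + (t - s) powr (\<gamma> - \<eta>)))"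

definition H4 ::
    "real \<Rightarrow> real \<Rightarrow> (real \<Rightarrow> ('h::complex_hilbert, 'h) oper)
       \<Rightarrow> (real \<Rightarrow> real \<Rightarrow> 'h \<Rightarrow>\<^sub>L 'h) \<Rightarrow> bool" where
  "H4 T \<delta> A E \<longleftrightarrow> (\<forall>\<eta> \<in> {0..1}. \<forall>\<gamma> \<in> {0..1}.
     (\<exists>N.
       (\<forall>s \<tau> t. 0 \<le> s \<and> s < \<tau> \<and> \<tau> \<le> t \<and> t \<le> T \<longrightarrow>
          norm (bop (frac_evol A E \<eta> \<gamma> t s) - bop (frac_evol A E \<eta> \<gamma> \<tau> s))
            \<le> N * (t - \<tau>) powr \<delta> * (1 + (\<tau> - s) powr (\<gamma> - \<eta> - \<delta>)))
       \<and> (\<forall>s \<sigma> t. 0 \<le> s \<and> s \<le> \<sigma> \<and> \<sigma> < t \<and> t \<le> T \<longrightarrow>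
          norm (bop (frac_evol_adj A E \<eta> \<gamma> t \<sigma>) - bop (frac_evol_adj A E \<eta> \<gamma> t s))
            \<le> N * (\<sigma> - s) powr \<delta> * (1 + (t - \<sigma>) powr (\<gamma> - \<eta> - \<delta>))))
     \<and> (\<forall>x. continuous_on {(t, s). 0 \<le> s \<and> s < t \<and> t \<le> T}
               (\<lambda>(t, s). bop (frac_evol A E \<eta> \<gamma> t s) x)
           \<and> continuous_on {(t, s). 0 \<le> s \<and> s < t \<and> t \<le> T}
               (\<lambda>(t, s). bop (frac_evol_adj A E \<eta> \<gamma> t s) x)))"

definition frac_G ::
    "(real \<Rightarrow> ('h::complex_hilbert, 'h) oper) \<Rightarrow> (real \<Rightarrow> 'u::complex_hilbert \<Rightarrow>\<^sub>L 'h)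
       \<Rightarrow> real \<Rightarrow> real \<Rightarrow> ('u, 'h) oper" where
  "frac_G A G \<alpha> t = bgraph (G t) O pos_pow (A t) \<alpha>"

definition H5 ::
    "real \<Rightarrow> real \<Rightarrow> real \<Rightarrow> (real \<Rightarrow> ('h::complex_hilbert, 'h) oper)
       \<Rightarrow> (real \<Rightarrow> 'u::complex_hilbert \<Rightarrow>\<^sub>L 'h) \<Rightarrow> bool" where
  "H5 T \<delta> \<alpha> A G \<longleftrightarrow> \<delta> < \<alpha> \<and> \<alpha> < 1 / 2
     \<and> (\<forall>t \<in> {0..T}. clinear_op (G t) \<and> bounded_oper (frac_G A G \<alpha> t))
     \<and> holder_on T \<delta> (\<lambda>t. bop (frac_G A G \<alpha> t))"

definition H6 ::
    "real \<Rightarrow> real \<Rightarrow> (real \<Rightarrow> 'h::complex_hilbert \<Rightarrow>\<^sub>L 'h)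
       \<Rightarrow> (real \<Rightarrow> 'u::complex_hilbert \<Rightarrow>\<^sub>L 'u) \<Rightarrow> bool" where
  "H6 T \<delta> M N \<longleftrightarrow> (\<forall>t \<in> {0..T}. M t \<in> Sigma_plus) \<and> holder_on T \<delta> M
     \<and> (\<forall>t \<in> {0..T}. N t \<in> Sigma_plus) \<and> holder_on T \<delta> N
     \<and> (\<exists>\<nu> > 0. \<forall>t \<in> {0..T}. \<forall>u. \<nu> * (norm u)\<^sup>2 \<le> Re (cinner (N t u) u))"


section \<open>The control problem\<close>

text \<open>The product \<open>E(t,s) A(s) G(s)\<close>, by convention
  \<open>- ([-A(s)*] to the 1-\<alpha>  E(t,s)*)* [-A(s)]\<^sup>\<alpha> G(s)\<close>.\<close>

definition EAG ::
    "(real \<Rightarrow> ('h::complex_hilbert, 'h) oper) \<Rightarrow> (real \<Rightarrow> real \<Rightarrow> 'h \<Rightarrow>\<^sub>L 'h)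
       \<Rightarrow> (real \<Rightarrow> 'u::complex_hilbert \<Rightarrow>\<^sub>L 'h) \<Rightarrow> real \<Rightarrow> real \<Rightarrow> real \<Rightarrow> ('u \<Rightarrow>\<^sub>L 'h)" where
  "EAG A E G \<alpha> t s =
     - (badj (bop (bgraph (badj (E t s)) O pos_pow (oper_adj (A s)) (1 - \<alpha>)))
          o\<^sub>L bop (frac_G A G \<alpha> s))"

text \<open>The product \<open>G(r)* A(r)* B\<close>, by convention \<open>- ([-A(r)]\<^sup>\<alpha> G(r))* [-A(r)*] to the 1-\<alpha>  B\<close>.\<close>

definition GAB ::
    "(real \<Rightarrow> ('h::complex_hilbert, 'h) oper) \<Rightarrow> (real \<Rightarrow> 'u::complex_hilbert \<Rightarrow>\<^sub>L 'h)
       \<Rightarrow> real \<Rightarrow> real \<Rightarrow> ('h \<Rightarrow>\<^sub>L 'h) \<Rightarrow> ('h \<Rightarrow>\<^sub>L 'u)" where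
  "GAB A G \<alpha> r B =
     - (badj (bop (frac_G A G \<alpha> r)) o\<^sub>L bop (bgraph B O pos_pow (oper_adj (A r)) (1 - \<alpha>)))"

definition Ls ::
    "(real \<Rightarrow> ('h::complex_hilbert, 'h) oper) \<Rightarrow> (real \<Rightarrow> real \<Rightarrow> 'h \<Rightarrow>\<^sub>L 'h)
       \<Rightarrow> (real \<Rightarrow> 'u::complex_hilbert \<Rightarrow>\<^sub>L 'h) \<Rightarrow> real \<Rightarrow> real \<Rightarrow> (real \<Rightarrow> 'u) \<Rightarrow> real \<Rightarrow> 'h" where
  "Ls A E G \<alpha> s u t = - integral {s..t} (\<lambda>r. EAG A E G \<alpha> t r (u r))"

definition LsT_int ::
    "real \<Rightarrow> (real \<Rightarrow> ('h::complex_hilbert, 'h) oper) \<Rightarrow> (real \<Rightarrow> real \<Rightarrow> 'h \<Rightarrow>\<^sub>L 'h)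
       \<Rightarrow> (real \<Rightarrow> 'u::complex_hilbert \<Rightarrow>\<^sub>L 'h) \<Rightarrow> real \<Rightarrow> real \<Rightarrow> (real \<Rightarrow> 'u) \<Rightarrow> 'h" where
  "LsT_int T A E G \<alpha> s u = integral {s..T} (\<lambda>r. bop ((A T)\<inverse>) (EAG A E G \<alpha> T r (u r)))"

definition LsT_dom ::
    "real \<Rightarrow> (real \<Rightarrow> ('h::complex_hilbert, 'h) oper) \<Rightarrow> (real \<Rightarrow> real \<Rightarrow> 'h \<Rightarrow>\<^sub>L 'h)
       \<Rightarrow> (real \<Rightarrow> 'u::complex_hilbert \<Rightarrow>\<^sub>L 'h) \<Rightarrow> real \<Rightarrow> real \<Rightarrow> (real \<Rightarrow> 'u) set" where
  "LsT_dom T A E G \<alpha> s = {u \<in> L2_space s T. LsT_int T A E G \<alpha> s u \<in> Domain (A T)}"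

definition LsT ::
    "real \<Rightarrow> (real \<Rightarrow> ('h::complex_hilbert, 'h) oper) \<Rightarrow> (real \<Rightarrow> real \<Rightarrow> 'h \<Rightarrow>\<^sub>L 'h)
       \<Rightarrow> (real \<Rightarrow> 'u::complex_hilbert \<Rightarrow>\<^sub>L 'h) \<Rightarrow> real \<Rightarrow> real \<Rightarrow> (real \<Rightarrow> 'u) \<Rightarrow> 'h" where
  "LsT T A E G \<alpha> s u = - oper_apply (A T) (LsT_int T A E G \<alpha> s u)"

definition H7 ::
    "real \<Rightarrow> (real \<Rightarrow> ('h::complex_hilbert, 'h) oper) \<Rightarrow> (real \<Rightarrow> real \<Rightarrow> 'h \<Rightarrow>\<^sub>L 'h)
       \<Rightarrow> (real \<Rightarrow> 'u::complex_hilbert \<Rightarrow>\<^sub>L 'h) \<Rightarrow> real \<Rightarrow> ('h \<Rightarrow>\<^sub>L 'h) \<Rightarrow> bool" where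
  "H7 T A E G \<alpha> PT \<longleftrightarrow> PT \<in> Sigma_plus
     \<and> (\<forall>v u z. (\<forall>n. v n \<in> LsT_dom T A E G \<alpha> 0) \<and> u \<in> L2_space 0 T \<and> L2_tendsto 0 T v u
           \<and> (\<lambda>n. sqrt_op PT (LsT T A E G \<alpha> 0 (v n))) \<longlonglongrightarrow> z
         \<longrightarrow> u \<in> LsT_dom T A E G \<alpha> 0 \<and> sqrt_op PT (LsT T A E G \<alpha> 0 u) = z)"

definition state ::
    "(real \<Rightarrow> ('h::complex_hilbert, 'h) oper) \<Rightarrow> (real \<Rightarrow> real \<Rightarrow> 'h \<Rightarrow>\<^sub>L 'h)
       \<Rightarrow> (real \<Rightarrow> 'u::complex_hilbert \<Rightarrow>\<^sub>L 'h) \<Rightarrow> real \<Rightarrow> real \<Rightarrow> 'h \<Rightarrow> (real \<Rightarrow> 'u) \<Rightarrow> real \<Rightarrow> 'h" where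
  "state A E G \<alpha> s x u t = E t s x + Ls A E G \<alpha> s u t"

text \<open>The element of \<open>H\<close> denoted by the product of the square root of \<open>PT\<close> with \<open>y(T)\<close>.\<close>

definition final_value ::
    "real \<Rightarrow> (real \<Rightarrow> ('h::complex_hilbert, 'h) oper) \<Rightarrow> (real \<Rightarrow> real \<Rightarrow> 'h \<Rightarrow>\<^sub>L 'h)
       \<Rightarrow> (real \<Rightarrow> 'u::complex_hilbert \<Rightarrow>\<^sub>L 'h) \<Rightarrow> real \<Rightarrow> ('h \<Rightarrow>\<^sub>L 'h)
       \<Rightarrow> real \<Rightarrow> 'h \<Rightarrow> (real \<Rightarrow> 'u) \<Rightarrow> 'h" where
  "final_value T A E G \<alpha> PT s x u = sqrt_op PT (E T s x) + sqrt_op PT (LsT T A E G \<alpha> s u)"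

definition cost ::
    "real \<Rightarrow> (real \<Rightarrow> ('h::complex_hilbert, 'h) oper) \<Rightarrow> (real \<Rightarrow> real \<Rightarrow> 'h \<Rightarrow>\<^sub>L 'h)
       \<Rightarrow> (real \<Rightarrow> 'u::complex_hilbert \<Rightarrow>\<^sub>L 'h) \<Rightarrow> real \<Rightarrow> (real \<Rightarrow> 'h \<Rightarrow>\<^sub>L 'h)
       \<Rightarrow> (real \<Rightarrow> 'u \<Rightarrow>\<^sub>L 'u) \<Rightarrow> ('h \<Rightarrow>\<^sub>L 'h) \<Rightarrow> real \<Rightarrow> 'h \<Rightarrow> (real \<Rightarrow> 'u) \<Rightarrow> ennreal" where
  "cost T A E G \<alpha> M N PT s x u =
     (if u \<in> LsT_dom T A E G \<alpha> s then
        (\<integral>\<^sup>+ r \<in> {s..T}. ennreal ((norm (sqrt_op (M r) (state A E G \<alpha> s x u r)))\<^sup>2) \<partial>lebesgue)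
        + (\<integral>\<^sup>+ r \<in> {s..T}. ennreal ((norm (sqrt_op (N r) (u r)))\<^sup>2) \<partial>lebesgue)
        + ennreal ((norm (final_value T A E G \<alpha> PT s x u))\<^sup>2)
      else \<infinity>)"

definition optimal_control ::
    "real \<Rightarrow> (real \<Rightarrow> ('h::complex_hilbert, 'h) oper) \<Rightarrow> (real \<Rightarrow> real \<Rightarrow> 'h \<Rightarrow>\<^sub>L 'h)
       \<Rightarrow> (real \<Rightarrow> 'u::complex_hilbert \<Rightarrow>\<^sub>L 'h) \<Rightarrow> real \<Rightarrow> (real \<Rightarrow> 'h \<Rightarrow>\<^sub>L 'h)
       \<Rightarrow> (real \<Rightarrow> 'u \<Rightarrow>\<^sub>L 'u) \<Rightarrow> ('h \<Rightarrow>\<^sub>L 'h) \<Rightarrow> real \<Rightarrow> 'h \<Rightarrow> (real \<Rightarrow> 'u) \<Rightarrow> bool" where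
  "optimal_control T A E G \<alpha> M N PT s x u \<longleftrightarrow> u \<in> L2_space s T
     \<and> (\<forall>v \<in> L2_space s T. cost T A E G \<alpha> M N PT s x u \<le> cost T A E G \<alpha> M N PT s x v)"


section \<open>The Riccati operator and the known facts that fix the objects\<close>

definition riccati_operator ::
    "real \<Rightarrow> (real \<Rightarrow> ('h::complex_hilbert, 'h) oper) \<Rightarrow> (real \<Rightarrow> real \<Rightarrow> 'h \<Rightarrow>\<^sub>L 'h)
       \<Rightarrow> (real \<Rightarrow> 'u::complex_hilbert \<Rightarrow>\<^sub>L 'h) \<Rightarrow> real \<Rightarrow> (real \<Rightarrow> 'h \<Rightarrow>\<^sub>L 'h)
       \<Rightarrow> (real \<Rightarrow> 'u \<Rightarrow>\<^sub>L 'u) \<Rightarrow> ('h \<Rightarrow>\<^sub>L 'h) \<Rightarrow> (real \<Rightarrow> 'h \<Rightarrow>\<^sub>L 'h) \<Rightarrow> bool" where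
  "riccati_operator T A E G \<alpha> M N PT P \<longleftrightarrow>
     (\<forall>s \<in> {0..<T}. P s \<in> Sigma_plus
        \<and> (\<forall>x u. optimal_control T A E G \<alpha> M N PT s x u \<longrightarrow>
              cost T A E G \<alpha> M N PT s x u = ennreal (Re (cinner (P s x) x))))"

text \<open>Known from the earlier theory: existence and uniqueness (up to null sets) of the optimal
  control, and continuity of the optimal state before the final time.\<close>

definition optimal_pairs_known ::
    "real \<Rightarrow> (real \<Rightarrow> ('h::complex_hilbert, 'h) oper) \<Rightarrow> (real \<Rightarrow> real \<Rightarrow> 'h \<Rightarrow>\<^sub>L 'h)
       \<Rightarrow> (real \<Rightarrow> 'u::complex_hilbert \<Rightarrow>\<^sub>L 'h) \<Rightarrow> real \<Rightarrow> (real \<Rightarrow> 'h \<Rightarrow>\<^sub>L 'h)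
       \<Rightarrow> (real \<Rightarrow> 'u \<Rightarrow>\<^sub>L 'u) \<Rightarrow> ('h \<Rightarrow>\<^sub>L 'h) \<Rightarrow> bool" where
  "optimal_pairs_known T A E G \<alpha> M N PT \<longleftrightarrow> (\<forall>s \<in> {0..<T}. \<forall>x.
     (\<exists>u. optimal_control T A E G \<alpha> M N PT s x u)
     \<and> (\<forall>u v. optimal_control T A E G \<alpha> M N PT s x u \<and> optimal_control T A E G \<alpha> M N PT s x v
          \<longrightarrow> (AE r in lebesgue. r \<in> {s..T} \<longrightarrow> u r = v r))
     \<and> (\<forall>u. optimal_control T A E G \<alpha> M N PT s x u \<longrightarrow>
          u \<in> LsT_dom T A E G \<alpha> s \<and> continuous_on {s..<T} (state A E G \<alpha> s x u)))"

text \<open>Known from the earlier theory: regularity of the Riccati operator, the integral Riccati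
  equation and the feedback formula. \<open>P(r) A(r) G(r)\<close> is read as the adjoint of
  \<open>G(r)* A(r)* P(r)\<close>, and the integral equation between operators is read weakly, that is, after
  applying both sides to \<open>x\<close> and pairing with \<open>z\<close>. The feedback formula holds for almost every
  time because a control is only determined up to null sets.\<close>

definition riccati_known ::
    "real \<Rightarrow> (real \<Rightarrow> ('h::complex_hilbert, 'h) oper) \<Rightarrow> (real \<Rightarrow> real \<Rightarrow> 'h \<Rightarrow>\<^sub>L 'h)
       \<Rightarrow> (real \<Rightarrow> 'u::complex_hilbert \<Rightarrow>\<^sub>L 'h) \<Rightarrow> real \<Rightarrow> (real \<Rightarrow> 'h \<Rightarrow>\<^sub>L 'h)
       \<Rightarrow> (real \<Rightarrow> 'u \<Rightarrow>\<^sub>L 'u) \<Rightarrow> ('h \<Rightarrow>\<^sub>L 'h) \<Rightarrow> (real \<Rightarrow> 'h \<Rightarrow>\<^sub>L 'h) \<Rightarrow> bool" where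
  "riccati_known T A E G \<alpha> M N PT P \<longleftrightarrow>
     bounded (P ` {0..<T}) \<and> continuous_on {0..<T} P
     \<and> (\<forall>x. ((\<lambda>t. P t x) \<longlongrightarrow> PT x) (at_left T))
     \<and> (\<exists>c. \<forall>t \<in> {0..<T}.
          bounded_oper (bgraph (P t) O pos_pow (oper_adj (A t)) (1 - \<alpha>))
          \<and> norm (bop (bgraph (P t) O pos_pow (oper_adj (A t)) (1 - \<alpha>)))
              \<le> c * (T - t) powr (\<alpha> - 1))
     \<and> (\<forall>t \<in> {0..<T}. \<forall>x z.
          ((\<lambda>r. cinner ((badj (E r t)
                          o\<^sub>L (M r - (badj (GAB A G \<alpha> r (P r)) o\<^sub>L bop ((bgraph (N r))\<inverse>)
                                        o\<^sub>L GAB A G \<alpha> r (P r)))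
                          o\<^sub>L E r t) x) z)
             has_integral cinner ((P t - (badj (E T t) o\<^sub>L PT o\<^sub>L E T t)) x) z) {t..T})
     \<and> (\<forall>s \<in> {0..<T}. \<forall>x u. optimal_control T A E G \<alpha> M N PT s x u \<longrightarrow>
          (AE t in lebesgue. t \<in> {s..<T} \<longrightarrow>
             u t = bop ((bgraph (N t))\<inverse>) (GAB A G \<alpha> t (P t) (state A E G \<alpha> s x u t))))"

end

theory Submission
  imports Defs
begin

text \<open>Put \<open>\<eta> = U(T,s) x + L\<^bsub>sT\<^esub> u\<close>, so that the value prescribed at \<open>T\<close> is the square root of
  \<open>P\<^bsub>T\<^esub>\<close> applied to \<open>\<eta>\<close>. The optimal control \<open>u\<close>, restricted to \<open>[t,T]\<close>, is admissible for the problem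
  with initial datum \<open>y(t) - \<eta>\<close> at time \<open>t\<close>, and the state it generates is \<open>y(r) - U(r,t) \<eta>\<close>. The squared
  norm of \<open>P(t)\<^sup>1\<^sup>/\<^sup>2 (y(t) - \<eta>)\<close> is the minimal cost for that datum, hence at most the cost of \<open>u\<close>, which is
  the sum of two tails of convergent integrals and of the squared norm of the square root of \<open>P\<^bsub>T\<^esub>\<close> at
  \<open>\<eta> - U(T,t) \<eta>\<close>; so it tends to \<open>0\<close>. It remains to note that square roots of nonnegative
  operators depend continuously on the operator in the strong topology, so that \<open>P(t)\<^sup>1\<^sup>/\<^sup>2 \<eta>\<close>
  converges to the prescribed value.\<close>

section \<open>Square roots of nonnegative operators\<close>

lemma tendsto_blinfun_apply_strong:
  fixes S :: "'t \<Rightarrow> 'a::real_normed_vector \<Rightarrow>\<^sub>L 'b::real_normed_vector"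
  assumes S: "\<And>z. ((\<lambda>t. S t z) \<longlongrightarrow> S0 z) F"
    and K: "eventually (\<lambda>t. norm (S t) \<le> K) F"
    and v: "(v \<longlongrightarrow> v0) F"
  shows "((\<lambda>t. S t (v t)) \<longlongrightarrow> S0 v0) F"
proof -
  have "((\<lambda>t. S t (v t - v0)) \<longlongrightarrow> 0) F"
  proof (rule Lim_null_comparison)
    show "eventually (\<lambda>t. norm (S t (v t - v0)) \<le> K * norm (v t - v0)) F"
      using K
    proof eventually_elim
      case (elim t)
      show ?case
        by (rule order_trans[OF norm_blinfun mult_right_mono[OF elim norm_ge_zero]])
    qed
    have "((\<lambda>t. K * norm (v t - v0)) \<longlongrightarrow> K * norm (v0 - v0)) F"
      by (intro tendsto_intros v)
    then show "((\<lambda>t. K * norm (v t - v0)) \<longlongrightarrow> 0) F"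
      by simp
  qed
  from tendsto_add[OF this S[of v0]] show ?thesis
    by (simp add: blinfun.diff_right)
qed

lemma clinear_op_scaleC: "clinear_op B \<Longrightarrow> B (c *\<^sub>C x) = c *\<^sub>C B x"
  by (simp add: clinear_op_def)

lemma scaleC_diff_right: "c *\<^sub>C (x - y) = c *\<^sub>C x - c *\<^sub>C (y::'a::complex_hilbert)"
  by (metis add_diff_cancel diff_add_cancel scaleC_add_right)

lemma scaleC_scaleR: "c *\<^sub>C (r *\<^sub>R x) = r *\<^sub>R (c *\<^sub>C (x::'a::complex_hilbert))"
  by (simp add: scaleR_eq_scaleC scaleC_scaleC mult.commute)

lemma scaleC_zero_right: "c *\<^sub>C (0::'a::complex_hilbert) = 0"
  using scaleC_diff_right[of c 0 0] by simp

lemma scaleC_minus_right: "c *\<^sub>C (- x) = - (c *\<^sub>C (x::'a::complex_hilbert))"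
  using scaleC_diff_right[of c 0 x] by (simp add: scaleC_zero_right)

lemma cinner_scaleC_right: "cinner x (c *\<^sub>C y) = cnj c * cinner x (y::'a::complex_hilbert)"
  by (metis cinner_commute cinner_scaleC_left complex_cnj_mult)

lemma Im_cinner: "Im (cinner x y) = - inner (\<i> *\<^sub>C x) (y::'a::complex_hilbert)"
  by (simp add: inner_eq_Re_cinner cinner_scaleC_left)

lemma cinner_eqI:
  fixes x :: "'a::complex_hilbert" and x' :: "'b::complex_hilbert"
  assumes "inner x y = inner x' y'" "inner (\<i> *\<^sub>C x) y = inner (\<i> *\<^sub>C x') y'"
  shows "cinner x y = cinner x' y'"
  using assms by (simp add: complex_eq_iff Im_cinner) (simp add: inner_eq_Re_cinner)

lemma norm_scaleC: "norm (c *\<^sub>C x) = cmod c * norm (x::'a::complex_hilbert)"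
proof -
  have "(norm (c *\<^sub>C x))\<^sup>2 = Re (c * cnj c * cinner x x)"
    by (simp only: power2_norm_eq_inner inner_eq_Re_cinner cinner_scaleC_left cinner_scaleC_right
        mult_ac)
  also have "c * cnj c = complex_of_real ((cmod c)\<^sup>2)"
    by (rule complex_norm_square[symmetric])
  also have "Re (complex_of_real ((cmod c)\<^sup>2) * cinner x x) = (cmod c * norm x)\<^sup>2"
    by (simp only: Re_complex_of_real Im_complex_of_real mult_zero_left diff_zero times_complex.sel
        power_mult_distrib power2_norm_eq_inner inner_eq_Re_cinner)
  finally show ?thesis
    by (simp add: power2_eq_iff_nonneg)
qed

lemma bounded_linear_scaleC: "bounded_linear ((*\<^sub>C) c :: 'a::complex_hilbert \<Rightarrow> 'a)"
  by (rule bounded_linear_intro[where K = "cmod c"])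
    (auto simp: scaleC_add_right scaleC_scaleR norm_scaleC)

lemma Sigma_plus_iff:
  "B \<in> Sigma_plus \<longleftrightarrow> clinear_op B \<and> (\<forall>x y. inner (B x) y = inner x (B y)) \<and> (\<forall>x. 0 \<le> inner (B x) x)"
proof -
  have "cinner (B x) y = cinner x (B y)"
    if "clinear_op B" "\<forall>x y. inner (B x) y = inner x (B y)" for x y
    by (rule cinner_eqI) (use that clinear_op_scaleC[of B] in metis)+
  then show ?thesis
    by (auto simp: Sigma_plus_def) (auto simp: inner_eq_Re_cinner)
qed

lemma Sigma_plusD:
  assumes "B \<in> Sigma_plus"
  shows "clinear_op B" "inner (B x) y = inner x (B y)" "0 \<le> inner (B x) x"
  using assms by (auto simp: Sigma_plus_iff)

lemma clinear_op_simps [simp]: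
  "clinear_op 0" "clinear_op id_blinfun"
  "clinear_op B \<Longrightarrow> clinear_op C \<Longrightarrow> clinear_op (B + C)"
  "clinear_op B \<Longrightarrow> clinear_op C \<Longrightarrow> clinear_op (B - C)"
  "clinear_op B \<Longrightarrow> clinear_op (- B)"
  "clinear_op B \<Longrightarrow> clinear_op (r *\<^sub>R B)"
  "clinear_op B' \<Longrightarrow> clinear_op C \<Longrightarrow> clinear_op (B' o\<^sub>L C)"
  by (auto simp: clinear_op_def blinfun.add_left blinfun.diff_left blinfun.minus_left
      blinfun.scaleR_left scaleC_add_right scaleC_diff_right scaleC_minus_right scaleC_scaleR
      scaleC_zero_right)

lemma Sigma_plus_norm_le:
  assumes A: "A \<in> Sigma_plus"
  shows "(norm (A x))\<^sup>2 \<le> norm A * inner (A x) x"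
proof (cases "norm A = 0")
  case True
  then show ?thesis by simp
next
  case False
  define n where "n = norm A"
  define t where "t = 1 / n"
  have n: "n > 0" using False by (simp add: n_def)
  have "0 \<le> inner (A (x - t *\<^sub>R A x)) (x - t *\<^sub>R A x)"
    using A by (rule Sigma_plusD)
  also have "\<dots> = inner (A x) x - 2 * t * inner (A x) (A x) + t\<^sup>2 * inner (A (A x)) (A x)"
    by (simp add: blinfun.diff_right blinfun.scaleR_right inner_diff_left inner_diff_right
        Sigma_plusD(2)[OF A, of "A x"] power2_eq_square algebra_simps)
  also have "inner (A (A x)) (A x) \<le> n * inner (A x) (A x)"
  proof -
    have "inner (A (A x)) (A x) \<le> norm (A (A x)) * norm (A x)"
      by (rule norm_cauchy_schwarz)
    also have "\<dots> \<le> (n * norm (A x)) * norm (A x)"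
      unfolding n_def by (intro mult_right_mono norm_blinfun norm_ge_zero)
    finally show ?thesis
      by (simp add: power2_norm_eq_inner[symmetric] power2_eq_square)
  qed
  finally have "0 \<le> inner (A x) x - 2 * t * inner (A x) (A x) + t\<^sup>2 * (n * inner (A x) (A x))"
    by (simp add: mult_left_mono)
  also have "t\<^sup>2 * (n * inner (A x) (A x)) = t * inner (A x) (A x)"
    using n by (simp add: t_def power2_eq_square)
  finally have "t * inner (A x) (A x) \<le> inner (A x) x"
    by simp
  then show ?thesis
    using n by (simp add: t_def n_def power2_norm_eq_inner field_simps)
qed

lemma Sigma_plus_zeroI:
  assumes "A \<in> Sigma_plus" "inner (A x) x = 0"
  shows "A x = 0"
  using Sigma_plus_norm_le[OF assms(1), of x] assms(2) by simp

lemma norm_id_minus_Sigma_plus: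
  assumes A: "A \<in> Sigma_plus" and "norm A \<le> 1"
  shows "norm (id_blinfun - A) \<le> 1"
proof (rule norm_blinfun_bound)
  fix x
  have "norm A * inner (A x) x \<le> 1 * inner (A x) x"
    by (rule mult_right_mono) (use assms Sigma_plusD(3)[OF A] in auto)
  then have "(norm (A x))\<^sup>2 \<le> inner (A x) x"
    using Sigma_plus_norm_le[OF A, of x] by simp
  then have "(norm ((id_blinfun - A) x))\<^sup>2 \<le> (norm x)\<^sup>2"
    using Sigma_plusD(3)[OF A, of x]
    by (simp add: blinfun.diff_left power2_norm_eq_inner inner_diff_left inner_diff_right
        inner_commute)
  then show "norm ((id_blinfun - A) x) \<le> 1 * norm x"
    by (simp add: power2_le_iff_abs_le)
qed simp

text \<open>If \<open>X = (B + X\<^sup>2) / 2\<close> then \<open>(1 - X)\<^sup>2 = 1 - B\<close>. The iteration converges in norm uniformly on the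
  unit ball, because it is dominated by the same iteration for the number \<open>1\<close>.\<close>

primrec root_iter :: "('a::real_normed_vector \<Rightarrow>\<^sub>L 'a) \<Rightarrow> nat \<Rightarrow> ('a \<Rightarrow>\<^sub>L 'a)" where
  "root_iter B 0 = 0"
| "root_iter B (Suc n) = (1 / 2) *\<^sub>R (B + (root_iter B n o\<^sub>L root_iter B n))"

primrec root_majorant :: "nat \<Rightarrow> real" where
  "root_majorant 0 = 0"
| "root_majorant (Suc n) = (1 + (root_majorant n)\<^sup>2) / 2"

lemma root_majorant_bounds: "0 \<le> root_majorant n \<and> root_majorant n \<le> 1"
proof (induction n)
  case (Suc n)
  then have "(root_majorant n)\<^sup>2 \<le> 1"
    by (simp add: power_le_one)
  then show ?case by simp
qed simp

lemma root_majorant_Suc: "root_majorant n \<le> root_majorant (Suc n)"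
  using sum_squares_bound[of 1 "root_majorant n"] by simp

lemma incseq_root_majorant: "incseq root_majorant"
  by (rule incseq_SucI) (rule root_majorant_Suc)

lemma root_majorant_tendsto: "root_majorant \<longlonglongrightarrow> 1"
proof -
  obtain L where L: "root_majorant \<longlonglongrightarrow> L"
    using incseq_convergent[OF incseq_root_majorant, of 1] root_majorant_bounds by blast
  have "(\<lambda>n. root_majorant (Suc n)) \<longlonglongrightarrow> (1 + L\<^sup>2) / 2"
    unfolding root_majorant.simps by (intro tendsto_intros L) simp
  then have eq: "(1 + L\<^sup>2) / 2 = L"
    using LIMSEQ_unique LIMSEQ_Suc[OF L] by blast
  have "1 + L\<^sup>2 = 2 * L"
    using eq by simp
  then have "(L - 1)\<^sup>2 = 0"
    by (simp add: power2_eq_square algebra_simps)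
  with L show ?thesis by simp
qed

lemma norm_root_iter:
  assumes "norm B \<le> 1"
  shows "norm (root_iter B n) \<le> root_majorant n"
proof (induction n)
  case (Suc n)
  have "norm (B + (root_iter B n o\<^sub>L root_iter B n)) \<le> 1 + root_majorant n * root_majorant n"
    by (intro norm_triangle_mono assms order_trans[OF norm_blinfun_compose] mult_mono Suc)
      (auto simp: root_majorant_bounds)
  then show ?case
    by (simp add: power2_eq_square)
qed simp

lemma norm_root_iter_Suc_diff:
  assumes "norm B \<le> 1"
  shows "norm (root_iter B (Suc n) - root_iter B n) \<le> root_majorant (Suc n) - root_majorant n"
proof (induction n)
  case 0
  show ?case using assms by simp
next
  case (Suc n)
  let ?X = "root_iter B" and ?x = root_majorant
  have "?X (Suc (Suc n)) - ?X (Suc n) = (1 / 2) *\<^sub>R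
      ((?X (Suc n) o\<^sub>L (?X (Suc n) - ?X n)) + ((?X (Suc n) - ?X n) o\<^sub>L ?X n))"
    by (simp only: root_iter.simps(2)[of B "Suc n"])
      (subst (4) root_iter.simps(2), simp add: bounded_bilinear.diff_left[OF bounded_bilinear_blinfun_compose]
        bounded_bilinear.diff_right[OF bounded_bilinear_blinfun_compose]
        flip: scaleR_diff_right)
  also have "norm \<dots> \<le> (1 / 2) * (?x (Suc n) * (?x (Suc n) - ?x n) + (?x (Suc n) - ?x n) * ?x n)"
    unfolding norm_scaleR
    by (intro mult_mono norm_triangle_mono order_trans[OF norm_blinfun_compose] Suc norm_root_iter
        assms) (auto simp: root_majorant_bounds simp del: root_majorant.simps intro!: add_nonneg_nonneg
        mult_nonneg_nonneg root_majorant_Suc)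
  also have "\<dots> = ?x (Suc (Suc n)) - ?x (Suc n)"
    by (simp only: root_majorant.simps(2)[of "Suc n"])
      (simp add: root_majorant.simps(2)[of n] power2_eq_square field_simps)
  finally show ?case .
qed

lemma norm_root_iter_diff:
  assumes "norm B \<le> 1"
  shows "norm (root_iter B (n + k) - root_iter B n) \<le> root_majorant (n + k) - root_majorant n"
proof (induction k)
  case (Suc k)
  have "norm (root_iter B (n + Suc k) - root_iter B n)
      \<le> norm (root_iter B (Suc (n + k)) - root_iter B (n + k)) + norm (root_iter B (n + k) - root_iter B n)"
    by (rule order_trans[OF _ norm_triangle_ineq]) simp
  also have "\<dots> \<le> root_majorant (n + Suc k) - root_majorant n"
    using norm_root_iter_Suc_diff[OF assms, of "n + k"] Suc by simp
  finally show ?case .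
qed simp

definition root_lim :: "('a::banach \<Rightarrow>\<^sub>L 'a) \<Rightarrow> ('a \<Rightarrow>\<^sub>L 'a)" where
  "root_lim B = lim (root_iter B)"

lemma root_iter_tendsto:
  fixes B :: "'a::banach \<Rightarrow>\<^sub>L 'a"
  assumes "norm B \<le> 1"
  shows "root_iter B \<longlonglongrightarrow> root_lim B"
proof -
  have "Cauchy (root_iter B)"
  proof (rule CauchyI)
    fix e :: real assume "e > 0"
    then obtain n0 where n0: "\<And>n. n \<ge> n0 \<Longrightarrow> norm (root_majorant n - 1) < e"
      using LIMSEQ_D[OF root_majorant_tendsto] by blast
    have *: "norm (root_iter B m - root_iter B n) < e" if "n0 \<le> n" "n \<le> m" for m n
      using norm_root_iter_diff[OF assms, of n "m - n"] that n0[of n] root_majorant_bounds[of m]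
      by (simp add: abs_less_iff)
    show "\<exists>M. \<forall>m\<ge>M. \<forall>n\<ge>M. norm (root_iter B m - root_iter B n) < e"
      using * by (metis linear norm_minus_commute)
  qed
  then show ?thesis
    unfolding root_lim_def using Cauchy_convergent convergent_LIMSEQ_iff by blast
qed

lemma norm_root_lim_diff:
  fixes B :: "'a::banach \<Rightarrow>\<^sub>L 'a"
  assumes "norm B \<le> 1"
  shows "norm (root_lim B - root_iter B n) \<le> 1 - root_majorant n"
proof (rule tendsto_le[OF sequentially_bot])
  show "(\<lambda>k. norm (root_iter B (n + k) - root_iter B n)) \<longlonglongrightarrow> norm (root_lim B - root_iter B n)"
    using LIMSEQ_ignore_initial_segment[OF root_iter_tendsto[OF assms], of n]
    by (intro tendsto_intros) (simp add: add.commute)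
  show "(\<lambda>k. root_majorant (n + k) - root_majorant n) \<longlonglongrightarrow> 1 - root_majorant n"
    using LIMSEQ_ignore_initial_segment[OF root_majorant_tendsto, of n]
    by (intro tendsto_intros) (simp add: add.commute)
qed (use norm_root_iter_diff[OF assms] in auto)

lemma norm_root_lim:
  fixes B :: "'a::banach \<Rightarrow>\<^sub>L 'a"
  assumes "norm B \<le> 1"
  shows "norm (root_lim B) \<le> 1"
  using norm_root_lim_diff[OF assms, of 0] by simp

lemma root_lim_fixpoint:
  fixes B :: "'a::banach \<Rightarrow>\<^sub>L 'a"
  assumes "norm B \<le> 1"
  shows "root_lim B = (1 / 2) *\<^sub>R (B + (root_lim B o\<^sub>L root_lim B))"
proof -
  note X = root_iter_tendsto[OF assms]
  have "(\<lambda>n. root_iter B (Suc n)) \<longlonglongrightarrow> (1 / 2) *\<^sub>R (B + (root_lim B o\<^sub>L root_lim B))"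
    unfolding root_iter.simps by (intro tendsto_intros X)
  then show ?thesis
    using LIMSEQ_unique LIMSEQ_Suc[OF X] by blast
qed

lemma root_iter_apply_tendsto:
  fixes B :: "'a::banach \<Rightarrow>\<^sub>L 'a"
  assumes "norm B \<le> 1"
  shows "(\<lambda>n. root_iter B n x) \<longlonglongrightarrow> root_lim B x"
  by (intro tendsto_intros root_iter_tendsto assms)

lemma root_lim_commute:
  fixes B :: "'a::banach \<Rightarrow>\<^sub>L 'a" and C :: "'a \<Rightarrow> 'a"
  assumes "norm B \<le> 1" and C: "bounded_linear C" and BC: "\<And>x. B (C x) = C (B x)"
  shows "root_lim B (C x) = C (root_lim B x)"
proof -
  interpret C: bounded_linear C by fact
  have "root_iter B n (C x) = C (root_iter B n x)" for n x
    by (induction n arbitrary: x)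
      (simp_all add: C.zero C.add C.scaleR BC blinfun.add_left blinfun.scaleR_left)
  then have "(\<lambda>n. C (root_iter B n x)) \<longlonglongrightarrow> root_lim B (C x)"
    using root_iter_apply_tendsto[OF assms(1), of "C x"] by simp
  moreover have "(\<lambda>n. C (root_iter B n x)) \<longlonglongrightarrow> C (root_lim B x)"
    by (rule C.tendsto) (rule root_iter_apply_tendsto[OF assms(1)])
  ultimately show ?thesis
    by (rule LIMSEQ_unique)
qed

lemma root_lim_selfadjoint:
  fixes B :: "'a::{real_inner,banach} \<Rightarrow>\<^sub>L 'a"
  assumes "norm B \<le> 1" and B: "\<And>x y. inner (B x) y = inner x (B y)"
  shows "inner (root_lim B x) y = inner x (root_lim B y)"
proof -
  have "inner (root_iter B n x) y = inner x (root_iter B n y)" for n x y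
    by (induction n arbitrary: x y)
      (simp_all add: B blinfun.add_left blinfun.scaleR_left inner_add_left inner_add_right)
  then have "(\<lambda>n. inner (root_iter B n x) y) \<longlonglongrightarrow> inner x (root_lim B y)"
    using tendsto_inner[OF tendsto_const root_iter_apply_tendsto[OF assms(1), of y]] by simp
  moreover have "(\<lambda>n. inner (root_iter B n x) y) \<longlonglongrightarrow> inner (root_lim B x) y"
    by (intro tendsto_intros root_iter_apply_tendsto[OF assms(1)])
  ultimately show ?thesis
    using LIMSEQ_unique by blast
qed

definition pos_root :: "real \<Rightarrow> ('a::complex_hilbert \<Rightarrow>\<^sub>L 'a) \<Rightarrow> ('a \<Rightarrow>\<^sub>L 'a)" where
  "pos_root c A = sqrt c *\<^sub>R (id_blinfun - root_lim (id_blinfun - (1 / c) *\<^sub>R A))"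

lemma norm_id_minus_scaled_Sigma_plus:
  assumes A: "A \<in> Sigma_plus" and c: "0 < c" "norm A \<le> c"
  shows "norm (id_blinfun - (1 / c) *\<^sub>R A) \<le> 1"
proof (rule norm_id_minus_Sigma_plus)
  show "(1 / c) *\<^sub>R A \<in> Sigma_plus"
    using A c by (auto simp: Sigma_plus_iff blinfun.scaleR_left)
  show "norm ((1 / c) *\<^sub>R A) \<le> 1"
    using c by (simp add: field_simps)
qed

lemma pos_root_Sigma_plus:
  assumes A: "A \<in> Sigma_plus" and c: "0 < c" "norm A \<le> c"
  shows "pos_root c A \<in> Sigma_plus"
proof -
  define B where "B = id_blinfun - (1 / c) *\<^sub>R A"
  have B: "norm B \<le> 1"
    unfolding B_def by (rule norm_id_minus_scaled_Sigma_plus) fact+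
  have Bc: "clinear_op B"
    using A by (simp add: B_def Sigma_plus_iff)
  have "clinear_op (root_lim B)"
    unfolding clinear_op_def
    by (intro allI root_lim_commute[OF B bounded_linear_scaleC] clinear_op_scaleC[OF Bc])
  moreover have "inner (root_lim B x) y = inner x (root_lim B y)" for x y
    by (rule root_lim_selfadjoint[OF B])
      (simp add: B_def blinfun.diff_left blinfun.scaleR_left inner_diff_left inner_diff_right
        Sigma_plusD(2)[OF A])
  moreover have "inner (root_lim B x) x \<le> inner x x" for x
  proof -
    have "inner (root_lim B x) x \<le> norm (root_lim B x) * norm x"
      by (rule norm_cauchy_schwarz)
    also have "\<dots> \<le> (1 * norm x) * norm x"
      by (intro mult_right_mono order_trans[OF norm_blinfun] norm_root_lim B norm_ge_zero)
    finally show ?thesis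
      by (simp add: power2_norm_eq_inner[symmetric] power2_eq_square)
  qed
  ultimately show ?thesis
    using c by (simp add: pos_root_def Sigma_plus_iff blinfun.diff_left blinfun.scaleR_left
        inner_diff_left inner_diff_right flip: B_def)
qed

lemma pos_root_square:
  assumes A: "A \<in> Sigma_plus" and c: "0 < c" "norm A \<le> c"
  shows "pos_root c A o\<^sub>L pos_root c A = A"
proof -
  define B where "B = id_blinfun - (1 / c) *\<^sub>R A"
  have B: "norm B \<le> 1"
    unfolding B_def by (rule norm_id_minus_scaled_Sigma_plus) fact+
  show ?thesis
  proof (rule blinfun_eqI)
    fix x
    have "2 *\<^sub>R root_lim B x = B x + root_lim B (root_lim B x)"
      by (subst root_lim_fixpoint[OF B]) (simp add: blinfun.add_left blinfun.scaleR_left)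
    then have "root_lim B (root_lim B x) = 2 *\<^sub>R root_lim B x - B x"
      by simp
    then have "(pos_root c A o\<^sub>L pos_root c A) x = (sqrt c * sqrt c) *\<^sub>R (x - B x)"
      by (simp add: pos_root_def blinfun.diff_left blinfun.scaleR_left blinfun.diff_right
          blinfun.scaleR_right scaleR_2 scaleR_diff_right scaleR_add_right flip: B_def)
    also have "\<dots> = A x"
      using c by (simp add: B_def blinfun.diff_left blinfun.scaleR_left)
    finally show "(pos_root c A o\<^sub>L pos_root c A) x = A x" .
  qed
qed

lemma sqrt_op_eq_pos_root:
  assumes A: "A \<in> Sigma_plus" and c: "0 < c" "norm A \<le> c"
  shows "sqrt_op A = pos_root c A"
  unfolding sqrt_op_def
proof (rule the_equality)
  show "pos_root c A \<in> Sigma_plus \<and> pos_root c A o\<^sub>L pos_root c A = A"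
    using pos_root_Sigma_plus[OF assms] pos_root_square[OF assms] by simp
next
  fix S assume "S \<in> Sigma_plus \<and> S o\<^sub>L S = A"
  then have S: "S \<in> Sigma_plus" and SS: "\<And>x. S (S x) = A x"
    by auto
  define R where "R = pos_root c A"
  have R: "R \<in> Sigma_plus" and RR: "\<And>x. R (R x) = A x"
    using pos_root_Sigma_plus[OF assms] pos_root_square[OF assms]
    by (auto simp: R_def simp flip: blinfun_apply_blinfun_compose)
  have comm: "R (S x) = S (R x)" for x
  proof -
    have "root_lim (id_blinfun - (1 / c) *\<^sub>R A) (S x) = S (root_lim (id_blinfun - (1 / c) *\<^sub>R A) x)"
      by (rule root_lim_commute[OF norm_id_minus_scaled_Sigma_plus[OF assms]])
        (simp_all add: blinfun.bounded_linear_right blinfun.diff_left blinfun.scaleR_left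
          blinfun.diff_right blinfun.scaleR_right flip: SS)
    then show ?thesis
      by (simp add: R_def pos_root_def blinfun.diff_left blinfun.scaleR_left blinfun.diff_right
          blinfun.scaleR_right)
  qed
  show "S = pos_root c A"
    unfolding R_def[symmetric]
  proof (rule blinfun_eqI)
    fix x
    define y where "y = S x - R x"
    have "S y + R y = 0"
      by (simp add: y_def blinfun.diff_right SS RR comm)
    then have "inner (S y) y + inner (R y) y = 0"
      by (metis inner_add_left inner_zero_left)
    then have "inner (S y) y = 0" "inner (R y) y = 0"
      using Sigma_plusD(3)[OF S, of y] Sigma_plusD(3)[OF R, of y] by auto
    then have "S y = 0" "R y = 0"
      using Sigma_plus_zeroI S R by blast+
    then have "inner y y = 0"
      using Sigma_plusD(2)[OF S, of y x] Sigma_plusD(2)[OF R, of y x]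
      by (subst (2) y_def) (simp add: inner_diff_right)
    then show "S x = R x"
      by (simp add: y_def)
  qed
qed

lemma sqrt_op_Sigma_plus: "A \<in> Sigma_plus \<Longrightarrow> sqrt_op A \<in> Sigma_plus"
  using pos_root_Sigma_plus[of A "norm A + 1"] sqrt_op_eq_pos_root[of A "norm A + 1"]
  by (simp add: add_nonneg_pos)

lemma sqrt_op_sqrt_op: "A \<in> Sigma_plus \<Longrightarrow> sqrt_op A (sqrt_op A x) = A x"
  using pos_root_square[of A "norm A + 1"] sqrt_op_eq_pos_root[of A "norm A + 1"]
  by (simp add: add_nonneg_pos flip: blinfun_apply_blinfun_compose)

lemma norm_sqrt_op_apply: "A \<in> Sigma_plus \<Longrightarrow> (norm (sqrt_op A x))\<^sup>2 = inner (A x) x"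
  by (metis Sigma_plusD(2) power2_norm_eq_inner sqrt_op_Sigma_plus sqrt_op_sqrt_op inner_commute)

lemma norm_sqrt_op_apply_le:
  assumes "A \<in> Sigma_plus" "norm A \<le> c"
  shows "(norm (sqrt_op A x))\<^sup>2 \<le> c * (norm x)\<^sup>2"
proof -
  have "inner (A x) x \<le> norm (A x) * norm x"
    by (rule norm_cauchy_schwarz)
  also have "\<dots> \<le> (c * norm x) * norm x"
    by (intro mult_right_mono order_trans[OF norm_blinfun] assms norm_ge_zero)
  finally have "inner (A x) x \<le> c * (norm x)\<^sup>2"
    by (simp add: power2_eq_square mult.assoc)
  then show ?thesis
    by (simp add: norm_sqrt_op_apply[OF assms(1)])
qed

lemma norm_sqrt_op_le:
  assumes "A \<in> Sigma_plus" "norm A \<le> c"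
  shows "norm (sqrt_op A) \<le> sqrt c"
proof (rule norm_blinfun_bound)
  have "0 \<le> c" using assms(2) norm_ge_zero order_trans by blast
  then show "0 \<le> sqrt c" by simp
  show "norm (sqrt_op A x) \<le> sqrt c * norm x" for x
    using real_le_rsqrt[OF norm_sqrt_op_apply_le[OF assms, of x]]
    by (simp add: real_sqrt_mult)
qed

lemma root_iter_apply_tendsto_strong:
  fixes B :: "'t \<Rightarrow> 'a::banach \<Rightarrow>\<^sub>L 'a" and B0 :: "'a \<Rightarrow>\<^sub>L 'a"
  assumes B: "\<And>z. ((\<lambda>t. B t z) \<longlongrightarrow> B0 z) F" and 1: "eventually (\<lambda>t. norm (B t) \<le> 1) F"
  shows "((\<lambda>t. root_iter (B t) n x) \<longlongrightarrow> root_iter B0 n x) F"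
proof (induction n arbitrary: x)
  case (Suc n)
  have "eventually (\<lambda>t. norm (root_iter (B t) n) \<le> root_majorant n) F"
    using 1 by eventually_elim (rule norm_root_iter)
  from tendsto_blinfun_apply_strong[OF Suc this Suc]
  show ?case
    unfolding root_iter.simps blinfun.add_left blinfun.scaleR_left blinfun_apply_blinfun_compose
    by (intro tendsto_scaleR tendsto_add tendsto_const B)
qed simp

lemma root_lim_apply_tendsto_strong:
  fixes B :: "'t \<Rightarrow> 'a::banach \<Rightarrow>\<^sub>L 'a" and B0 :: "'a \<Rightarrow>\<^sub>L 'a"
  assumes B: "\<And>z. ((\<lambda>t. B t z) \<longlongrightarrow> B0 z) F" and 1: "eventually (\<lambda>t. norm (B t) \<le> 1) F"
    and B0: "norm B0 \<le> 1"
  shows "((\<lambda>t. root_lim (B t) x) \<longlongrightarrow> root_lim B0 x) F"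
proof (rule tendstoI)
  fix e :: real assume e: "e > 0"
  have "(\<lambda>n. (1 - root_majorant n) * norm x) \<longlonglongrightarrow> (1 - 1) * norm x"
    by (intro tendsto_intros root_majorant_tendsto)
  then have "eventually (\<lambda>n. (1 - root_majorant n) * norm x < e / 4) sequentially"
    by (rule order_tendstoD) (use e in simp)
  then obtain n where n: "(1 - root_majorant n) * norm x < e / 4"
    by (auto simp: eventually_sequentially)
  have close: "norm (root_lim C x - root_iter C n x) \<le> (1 - root_majorant n) * norm x"
    if "norm C \<le> 1" for C :: "'a \<Rightarrow>\<^sub>L 'a"
    using order_trans[OF norm_blinfun mult_right_mono[OF norm_root_lim_diff[OF that, of n] norm_ge_zero]]
    by (simp add: blinfun.diff_left)
  have "eventually (\<lambda>t. dist (root_iter (B t) n x) (root_iter B0 n x) < e / 2) F"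
    by (rule tendstoD[OF root_iter_apply_tendsto_strong[OF B 1]]) (use e in simp)
  then show "eventually (\<lambda>t. dist (root_lim (B t) x) (root_lim B0 x) < e) F"
    using 1
  proof eventually_elim
    case (elim t)
    have "dist (root_lim (B t) x) (root_lim B0 x)
        \<le> dist (root_lim (B t) x) (root_iter (B t) n x) + dist (root_iter (B t) n x) (root_iter B0 n x)
          + dist (root_iter B0 n x) (root_lim B0 x)"
      by (meson dist_triangle order_trans add_right_mono)
    then show ?case
      using close[OF elim(2)] close[OF B0] elim(1) n
      unfolding dist_norm norm_minus_commute[of "root_iter B0 n x" "root_lim B0 x"] by linarith
  qed
qed

lemma sqrt_op_apply_tendsto_strong:
  fixes Q :: "'t \<Rightarrow> 'a::complex_hilbert \<Rightarrow>\<^sub>L 'a" and Q0 :: "'a \<Rightarrow>\<^sub>L 'a"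
  assumes Q: "\<And>z. ((\<lambda>t. Q t z) \<longlongrightarrow> Q0 z) F" and c: "eventually (\<lambda>t. norm (Q t) \<le> c) F"
    and S: "eventually (\<lambda>t. Q t \<in> Sigma_plus) F" and S0: "Q0 \<in> Sigma_plus"
  shows "((\<lambda>t. sqrt_op (Q t) x) \<longlongrightarrow> sqrt_op Q0 x) F"
proof -
  define d where "d = \<bar>c\<bar> + norm Q0 + 1"
  have d: "0 < d" "norm Q0 \<le> d" "c \<le> d"
    using norm_ge_zero[of Q0] by (auto simp: d_def simp del: norm_ge_zero)
  let ?B = "\<lambda>A :: 'a \<Rightarrow>\<^sub>L 'a. id_blinfun - (1 / d) *\<^sub>R A"
  have lim: "((\<lambda>t. root_lim (?B (Q t)) x) \<longlongrightarrow> root_lim (?B Q0) x) F"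
  proof (rule root_lim_apply_tendsto_strong)
    show "((\<lambda>t. ?B (Q t) z) \<longlongrightarrow> ?B Q0 z) F" for z
      unfolding blinfun.diff_left blinfun.scaleR_left by (intro tendsto_intros Q)
    show "eventually (\<lambda>t. norm (?B (Q t)) \<le> 1) F"
      using c S by eventually_elim (rule norm_id_minus_scaled_Sigma_plus, use d in auto)
    show "norm (?B Q0) \<le> 1"
      by (rule norm_id_minus_scaled_Sigma_plus[OF S0 d(1,2)])
  qed
  have pos_root_apply: "pos_root d A x = sqrt d *\<^sub>R (x - root_lim (?B A) x)" for A
    by (simp add: pos_root_def blinfun.scaleR_left blinfun.diff_left)
  have "((\<lambda>t. pos_root d (Q t) x) \<longlongrightarrow> pos_root d Q0 x) F"
    unfolding pos_root_apply by (rule tendsto_scaleR[OF tendsto_const tendsto_diff[OF tendsto_const lim]])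
  moreover have "eventually (\<lambda>t. pos_root d (Q t) x = sqrt_op (Q t) x) F"
    using c S by eventually_elim (subst sqrt_op_eq_pos_root[of _ d], use d in auto)
  ultimately show ?thesis
    unfolding sqrt_op_eq_pos_root[OF S0 d(1,2)] by (rule Lim_transform_eventually)
qed

lemma continuous_on_sqrt_op_apply:
  fixes Q :: "'t::topological_space \<Rightarrow> 'a::complex_hilbert \<Rightarrow>\<^sub>L 'a"
  assumes Q: "continuous_on S Q" "Q ` S \<subseteq> Sigma_plus" and v: "continuous_on S v"
  shows "continuous_on S (\<lambda>t. sqrt_op (Q t) (v t))"
  unfolding continuous_on_def
proof
  fix t assume t: "t \<in> S"
  have Qt: "(Q \<longlongrightarrow> Q t) (at t within S)" and vt: "(v \<longlongrightarrow> v t) (at t within S)"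
    using Q v t by (auto simp: continuous_on_def)
  define c where "c = norm (Q t) + 1"
  have c: "eventually (\<lambda>r. norm (Q r) < c) (at t within S)"
    by (rule order_tendstoD[OF tendsto_norm[OF Qt]]) (simp add: c_def)
  have S: "eventually (\<lambda>r. Q r \<in> Sigma_plus) (at t within S)"
    using Q(2) by (auto simp: eventually_at_filter image_subset_iff)
  show "((\<lambda>r. sqrt_op (Q r) (v r)) \<longlongrightarrow> sqrt_op (Q t) (v t)) (at t within S)"
  proof (rule tendsto_blinfun_apply_strong[OF _ _ vt])
    show "((\<lambda>r. sqrt_op (Q r) z) \<longlongrightarrow> sqrt_op (Q t) z) (at t within S)" for z
    proof (rule sqrt_op_apply_tendsto_strong[OF _ eventually_mono[OF c less_imp_le] S])
      show "((\<lambda>r. Q r w) \<longlongrightarrow> Q t w) (at t within S)" for w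
        by (intro tendsto_intros Qt)
    qed (use Q(2) t in auto)
    show "eventually (\<lambda>r. norm (sqrt_op (Q r)) \<le> sqrt c) (at t within S)"
      using c S by eventually_elim (rule norm_sqrt_op_le, auto)
  qed
qed


section \<open>Adjoints\<close>

text \<open>The functional \<open>x \<mapsto> \<parallel>x\<parallel>\<^sup>2 - 2 f x\<close> attains its infimum at the representing vector; minimizing
  sequences are Cauchy by the parallelogram law.\<close>

lemma riesz_representation:
  fixes f :: "'a::{real_inner,banach} \<Rightarrow> real"
  assumes "bounded_linear f"
  shows "\<exists>y. \<forall>x. f x = inner x y"
proof -
  interpret f: bounded_linear f by fact
  obtain K where K: "\<And>x. norm (f x) \<le> norm x * K"
    using f.bounded by blast
  define J where "J x = inner x x - 2 * f x" for x
  have below: "- (K\<^sup>2) \<le> J x" for x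
  proof -
    have "f x \<le> norm x * K"
      using K[of x] by simp
    moreover have "0 \<le> (norm x - K)\<^sup>2"
      by simp
    ultimately show ?thesis
      by (simp add: J_def power2_norm_eq_inner[symmetric] power2_eq_square algebra_simps)
  qed
  define d where "d = (INF x. J x)"
  have bdd: "bdd_below (range J)"
    using below by (intro bdd_belowI2)
  have d_le: "d \<le> J x" for x
    unfolding d_def by (rule cINF_lower[OF bdd]) simp
  have "\<exists>x. J x < d + inverse (real (Suc n))" for n
  proof (rule ccontr)
    assume "\<not> ?thesis"
    then have "d + inverse (real (Suc n)) \<le> d"
      unfolding d_def by (intro cINF_greatest) (auto simp: not_less d_def)
    then show False
      by (simp add: field_simps)
  qed
  then obtain X where X: "\<And>n. J (X n) < d + inverse (real (Suc n))"
    by metis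
  have par: "(norm (a - b))\<^sup>2 \<le> 2 * ((J a - d) + (J b - d))" for a b
  proof -
    have "J a + J b - 2 * J ((1 / 2) *\<^sub>R (a + b)) = (norm (a - b))\<^sup>2 / 2"
      by (simp add: J_def f.add f.scaleR power2_norm_eq_inner inner_commute algebra_simps)
    then show ?thesis
      using d_le[of "(1 / 2) *\<^sub>R (a + b)"] by simp
  qed
  have "Cauchy X"
  proof (rule metric_CauchyI)
    fix e :: real assume e: "e > 0"
    then obtain n0 where n0: "inverse (real (Suc n0)) < e\<^sup>2 / 4"
      using reals_Archimedean[of "e\<^sup>2 / 4"] by auto
    have "dist (X m) (X n) < e" if "m \<ge> n0" "n \<ge> n0" for m n
    proof -
      have close: "J (X k) < d + e\<^sup>2 / 4" if "k \<ge> n0" for k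
      proof -
        have "inverse (real (Suc k)) \<le> inverse (real (Suc n0))"
          using that by (intro le_imp_inverse_le) auto
        then have "d + inverse (real (Suc k)) < d + e\<^sup>2 / 4"
          by (intro add_strict_left_mono le_less_trans[OF _ n0])
        with X show ?thesis
          by (rule less_trans)
      qed
      have "(norm (X m - X n))\<^sup>2 < e\<^sup>2"
        using par[of "X m" "X n"] close[OF that(1)] close[OF that(2)] by simp
      then show ?thesis
        using e by (simp add: dist_norm power2_less_imp_less)
    qed
    then show "\<exists>M. \<forall>m\<ge>M. \<forall>n\<ge>M. dist (X m) (X n) < e"
      by blast
  qed
  then obtain y where y: "X \<longlonglongrightarrow> y"
    using Cauchy_convergent convergent_def by blast
  have "(\<lambda>n. J (X n)) \<longlonglongrightarrow> J y"
    unfolding J_def by (intro tendsto_intros y f.tendsto)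
  moreover have "(\<lambda>n. d + inverse (real (Suc n))) \<longlonglongrightarrow> d + 0"
    by (intro tendsto_intros LIMSEQ_inverse_real_of_nat)
  ultimately have "J y \<le> d + 0"
    by (rule LIMSEQ_le) (use X less_imp_le in blast)
  then have min: "J y \<le> J x" for x
    using d_le[of x] by simp
  have "f v = inner v y" for v
  proof (cases "v = 0")
    case True
    then show ?thesis by (simp add: f.zero)
  next
    case False
    define w where "w = inner v y - f v"
    define t where "t = - w / inner v v"
    have v: "inner v v > 0"
      using False by simp
    have "J (y + t *\<^sub>R v) = J y + 2 * t * w + t\<^sup>2 * inner v v"
      by (simp add: J_def w_def f.add f.scaleR inner_commute power2_eq_square algebra_simps)
    then have "0 \<le> 2 * t * w + t\<^sup>2 * inner v v"
      using min[of "y + t *\<^sub>R v"] by simp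
    also have "\<dots> = - (w\<^sup>2 / inner v v)"
      using v by (simp add: t_def power2_eq_square field_simps)
    finally have "w\<^sup>2 / inner v v \<le> 0"
      by simp
    then have "w\<^sup>2 \<le> 0"
      using v by (simp add: divide_le_0_iff)
    then have "w = 0"
      by simp
    then show ?thesis
      by (simp add: w_def)
  qed
  then show ?thesis
    by blast
qed

lemma adjoint_exists:
  fixes B :: "'a::{real_inner,banach} \<Rightarrow>\<^sub>L 'b::real_inner"
  obtains C :: "'b \<Rightarrow>\<^sub>L 'a" where "\<And>x y. inner (B x) y = inner x (C y)" "norm C \<le> norm B"
proof -
  have "\<exists>z. \<forall>x. inner (B x) y = inner x z" for y
    by (rule riesz_representation) (intro bounded_linear_intros)
  then obtain g where g: "\<And>x y. inner (B x) y = inner x (g y)"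
    by metis
  have norm_g: "norm (g y) \<le> norm y * norm B" for y
  proof -
    have "norm (g y) * norm (g y) = inner (B (g y)) y"
      by (simp add: g power2_norm_eq_inner[symmetric] power2_eq_square)
    also have "\<dots> \<le> norm (B (g y)) * norm y"
      by (rule norm_cauchy_schwarz)
    also have "\<dots> \<le> (norm B * norm (g y)) * norm y"
      by (intro mult_right_mono norm_blinfun norm_ge_zero)
    finally have "norm (g y) * norm (g y) \<le> norm (g y) * (norm y * norm B)"
      by (simp add: mult_ac)
    then show ?thesis
      by (cases "norm (g y) = 0") (auto simp: mult_le_cancel_left)
  qed
  have bl: "bounded_linear g"
  proof (rule bounded_linear_intro)
    show "g (x + y) = g x + g y" for x y
      by (rule vector_eq_ldot[THEN iffD1]) (simp add: inner_add_right flip: g)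
    show "g (r *\<^sub>R x) = r *\<^sub>R g x" for r x
      by (rule vector_eq_ldot[THEN iffD1]) (simp flip: g)
  qed (rule norm_g)
  show ?thesis
  proof
    show "inner (B x) y = inner x (Blinfun g y)" for x y
      by (simp add: bounded_linear_Blinfun_apply[OF bl] g)
    show "norm (Blinfun g) \<le> norm B"
      by (rule norm_blinfun_bound)
        (use norm_g in \<open>simp_all add: bounded_linear_Blinfun_apply[OF bl] mult.commute\<close>)
  qed
qed

lemma bgraph_iff: "(x, y) \<in> bgraph B \<longleftrightarrow> y = B x"
  by (auto simp: bgraph_def)

lemma bgraph_inj: "bgraph B = bgraph C \<Longrightarrow> B = C"
  by (metis bgraph_iff blinfun_eqI)

lemma bop_bgraph [simp]: "bop (bgraph B) = B"
  unfolding bop_def by (rule the_equality) (auto dest: bgraph_inj)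

lemma bounded_operD:
  assumes "bounded_oper R"
  shows "clinear_op (bop R)" "R = bgraph (bop R)"
  using assms by (auto simp: bounded_oper_def)

lemma bgraph_relcomp: "bgraph B O bgraph C = bgraph (C o\<^sub>L B)"
  by (auto simp: bgraph_iff relcomp_unfold)

lemma inner_scaleC_left:
  "inner (c *\<^sub>C x) y = inner x (cnj c *\<^sub>C (y::'a::complex_hilbert))"
  by (simp add: inner_eq_Re_cinner cinner_scaleC_left cinner_scaleC_right)

lemma oper_adj_bgraphI:
  fixes B :: "'a::complex_hilbert \<Rightarrow>\<^sub>L 'b::complex_hilbert" and C :: "'b \<Rightarrow>\<^sub>L 'a"
  assumes B: "clinear_op B" and C: "\<And>x y. inner (B x) y = inner x (C y)"
  shows "oper_adj (bgraph B) = bgraph C"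
proof -
  have "cinner (B x) y = cinner x (C y)" for x y
    by (rule cinner_eqI) (use C clinear_op_scaleC[OF B] in metis)+
  moreover have "z = C y" if "\<forall>x. cinner x (C y) = cinner x z" for y z
    by (rule vector_eq_ldot[THEN iffD1]) (use that in \<open>simp add: inner_eq_Re_cinner\<close>)
  ultimately show ?thesis
    by (auto simp: oper_adj_def bgraph_def)
qed

lemma badj_eqI:
  fixes B :: "'a::complex_hilbert \<Rightarrow>\<^sub>L 'b::complex_hilbert" and C :: "'b \<Rightarrow>\<^sub>L 'a"
  assumes "clinear_op B" "\<And>x y. inner (B x) y = inner x (C y)"
  shows "badj B = C"
  by (simp add: badj_def oper_adj_bgraphI[OF assms])

lemma
  fixes B :: "'a::complex_hilbert \<Rightarrow>\<^sub>L 'b::complex_hilbert"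
  assumes B: "clinear_op B"
  shows inner_badj: "inner (B x) y = inner x (badj B y)"
    and norm_badj_le: "norm (badj B) \<le> norm B"
    and clinear_op_badj [simp]: "clinear_op (badj B)"
    and bgraph_badj: "oper_adj (bgraph B) = bgraph (badj B)"
proof -
  obtain C :: "'b \<Rightarrow>\<^sub>L 'a" where C: "\<And>x y. inner (B x) y = inner x (C y)" "norm C \<le> norm B"
    using adjoint_exists[of B] by blast
  have eq: "badj B = C"
    by (rule badj_eqI[OF B C(1)])
  show "inner (B x) y = inner x (badj B y)" "norm (badj B) \<le> norm B"
    using C eq by auto
  have "C (c *\<^sub>C y) = c *\<^sub>C C y" for c y
  proof (rule vector_eq_ldot[THEN iffD1], rule allI)
    fix x
    have "inner (B x) (c *\<^sub>C y) = inner (B (cnj c *\<^sub>C x)) y"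
      by (simp add: clinear_op_scaleC[OF B] inner_scaleC_left)
    then show "inner x (C (c *\<^sub>C y)) = inner x (c *\<^sub>C C y)"
      by (simp add: C(1) inner_scaleC_left)
  qed
  then show "clinear_op (badj B)"
    by (simp add: eq clinear_op_def)
  show "oper_adj (bgraph B) = bgraph (badj B)"
    unfolding eq by (rule oper_adj_bgraphI[OF B C(1)])
qed

lemma badj_badj: "clinear_op B \<Longrightarrow> badj (badj B) = B"
  by (rule badj_eqI) (simp, metis inner_badj inner_commute)

lemma badj_compose: "clinear_op B \<Longrightarrow> clinear_op C \<Longrightarrow> badj (B o\<^sub>L C) = badj C o\<^sub>L badj B"
  by (rule badj_eqI) (simp_all add: inner_badj)

lemma badj_diff: "clinear_op B \<Longrightarrow> clinear_op C \<Longrightarrow> badj (B - C) = badj B - badj C"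
  by (rule badj_eqI) (simp_all add: inner_badj blinfun.diff_left inner_diff_left inner_diff_right)

lemma continuous_on_badj:
  fixes F :: "'t::metric_space \<Rightarrow> _"
  assumes "continuous_on S F" "\<And>t. t \<in> S \<Longrightarrow> clinear_op (F t)"
  shows "continuous_on S (\<lambda>t. badj (F t))"
  unfolding continuous_on_iff
proof (intro ballI allI impI)
  fix t and e :: real assume t: "t \<in> S" and "0 < e"
  then obtain d where d: "d > 0" "\<And>r. r \<in> S \<Longrightarrow> dist r t < d \<Longrightarrow> dist (F r) (F t) < e"
    using assms(1) unfolding continuous_on_iff by blast
  have "dist (badj (F r)) (badj (F t)) < e" if "r \<in> S" "dist r t < d" for r
    using norm_badj_le[of "F r - F t"] d(2)[OF that] assms(2)[OF t] assms(2)[OF that(1)]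
    by (simp add: dist_norm badj_diff)
  with d(1) show "\<exists>d>0. \<forall>r\<in>S. dist r t < d \<longrightarrow> dist (badj (F r)) (badj (F t)) < e"
    by blast
qed

lemma oper_adj_converse: "oper_adj (R\<inverse>) = (oper_adj R)\<inverse>"
proof -
  have "(a, b) \<in> oper_adj R \<longleftrightarrow> (\<forall>x w. (x, w) \<in> R \<longrightarrow> cinner w a = cinner x b)"
    for a b and R :: "('b, 'a) oper"
    by (auto simp: oper_adj_def)
  moreover have "(a, b) \<in> oper_adj R \<longleftrightarrow> (\<forall>x w. (x, w) \<in> R \<longrightarrow> cinner w a = cinner x b)"
    for a b and R :: "('a, 'b) oper"
    by (auto simp: oper_adj_def)
  ultimately show ?thesis
    by (auto 0 3)
qed

lemma norm_coercive_inverse_le: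
  fixes N :: "'u::complex_hilbert \<Rightarrow>\<^sub>L 'u"
  assumes N: "N \<in> Sigma_plus" and \<nu>: "\<nu> > 0" "\<And>u. \<nu> * (norm u)\<^sup>2 \<le> inner (N u) u"
  shows "norm (bop ((bgraph N)\<inverse>) v) \<le> norm v / \<nu>"
proof -
  have below: "\<nu> * norm u \<le> norm (N u)" for u
  proof -
    have "(\<nu> * norm u) * norm u \<le> norm (N u) * norm u"
      using order_trans[OF \<nu>(2) norm_cauchy_schwarz] by (simp add: power2_eq_square mult.assoc)
    then show ?thesis
      by (cases "u = 0") auto
  qed
  define c where "c = norm N + \<nu>"
  have c: "0 < c" "norm N \<le> c" "\<nu> \<le> c"
    using \<nu>(1) norm_ge_zero[of N] unfolding c_def by linarith+
  define B where "B = id_blinfun - (1 / c) *\<^sub>R N"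
  have B_le_1: "norm B \<le> 1"
    unfolding B_def by (rule norm_id_minus_scaled_Sigma_plus[OF N c(1,2)])
  have inner_B: "inner (B u) u = inner u u - inner (N u) u / c" for u
    by (simp add: B_def blinfun.diff_left blinfun.scaleR_left inner_diff_left)
  have B_le: "inner (B u) u \<le> (1 - \<nu> / c) * (norm u)\<^sup>2" for u
  proof -
    have "\<nu> * (norm u)\<^sup>2 / c \<le> inner (N u) u / c"
      by (intro divide_right_mono \<nu>(2)) (use c in simp)
    then show ?thesis
      by (simp add: inner_B power2_norm_eq_inner algebra_simps)
  qed
  have B: "B \<in> Sigma_plus"
    unfolding Sigma_plus_iff
  proof (intro conjI allI)
    show "clinear_op B"
      using Sigma_plusD(1)[OF N] by (simp add: B_def)
    show "inner (B x) y = inner x (B y)" for x y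
      by (simp add: B_def blinfun.diff_left blinfun.scaleR_left inner_diff_left inner_diff_right
          Sigma_plusD(2)[OF N])
    show "0 \<le> inner (B x) x" for x
    proof -
      have "inner (N x) x \<le> norm (N x) * norm x"
        by (rule norm_cauchy_schwarz)
      also have "\<dots> \<le> (c * norm x) * norm x"
        by (intro mult_right_mono order_trans[OF norm_blinfun] c norm_ge_zero)
      finally have "inner (N x) x \<le> c * inner x x"
        by (simp add: power2_norm_eq_inner[symmetric] power2_eq_square mult.assoc)
      then show ?thesis
        using c by (simp add: inner_B field_simps)
    qed
  qed
  have lip: "norm (B u) \<le> sqrt (1 - \<nu> / c) * norm u" for u
  proof -
    have "(norm (B u))\<^sup>2 \<le> norm B * inner (B u) u"
      by (rule Sigma_plus_norm_le[OF B])
    also have "\<dots> \<le> 1 * inner (B u) u"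
      by (intro mult_right_mono B_le_1 Sigma_plusD(3)[OF B])
    also have "\<dots> \<le> (1 - \<nu> / c) * (norm u)\<^sup>2"
      using B_le by simp
    finally show ?thesis
      using real_le_rsqrt by (fastforce simp: real_sqrt_mult)
  qed
  have surj: "\<exists>u. N u = v" for v
  proof -
    have "\<exists>!u. B u + (1 / c) *\<^sub>R v = u"
    proof (rule banach_fix_type)
      show "0 \<le> sqrt (1 - \<nu> / c)" "sqrt (1 - \<nu> / c) < 1"
        using c \<nu>(1) by (auto simp: field_simps)
      show "\<forall>x y. dist (B x + (1 / c) *\<^sub>R v) (B y + (1 / c) *\<^sub>R v) \<le> sqrt (1 - \<nu> / c) * dist x y"
        using lip by (auto simp: dist_norm simp flip: blinfun.diff_right)
    qed
    then obtain u where "B u + (1 / c) *\<^sub>R v = u"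
      by blast
    then have "(1 / c) *\<^sub>R N u = (1 / c) *\<^sub>R v"
      by (auto simp: B_def blinfun.diff_left blinfun.scaleR_left algebra_simps)
    then show ?thesis
      using c by (metis order_less_irrefl scaleR_cancel_left zero_less_divide_1_iff)
  qed
  then obtain g where g: "\<And>v. N (g v) = v"
    by metis
  have g_eq: "g v = u" if "N u = v" for u v
  proof -
    have "N (g v - u) = 0"
      by (simp add: blinfun.diff_right g that)
    then have "\<nu> * norm (g v - u) \<le> 0"
      using below[of "g v - u"] by simp
    then show ?thesis
      using \<nu>(1) by (simp add: mult_le_0_iff)
  qed
  have norm_g: "norm (g v) \<le> norm v / \<nu>" for v
    using below[of "g v"] \<nu>(1) by (simp add: g field_simps)
  have bl: "bounded_linear g"
    by (rule bounded_linear_intro[where K = "1 / \<nu>"])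
      (auto intro!: g_eq simp: blinfun.add_right blinfun.scaleR_right g norm_g)
  have "(bgraph N)\<inverse> = bgraph (Blinfun g)"
    by (auto simp: bgraph_iff bounded_linear_Blinfun_apply[OF bl] g intro!: g_eq[symmetric])
  then show ?thesis
    by (simp add: bounded_linear_Blinfun_apply[OF bl] norm_g)
qed


section \<open>Integration of vector-valued functions\<close>

text \<open>The target space need not be separable, so that Bochner integrability is not available here;
  the following criterion replaces it.\<close>

lemma integrable_on_L1_approx:
  fixes f :: "'n::euclidean_space \<Rightarrow> 'b::banach"
  assumes approx: "\<And>e. e > 0 \<Longrightarrow> \<exists>g h. g integrable_on cbox a b \<and> h integrable_on cbox a b
      \<and> (\<forall>x\<in>cbox a b. norm (f x - g x) \<le> h x) \<and> integral (cbox a b) h < e"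
  shows "f integrable_on cbox a b"
  unfolding integrable_Cauchy
proof (intro allI impI)
  fix e :: real assume "e > 0"
  then have e6: "e / 6 > 0" by simp
  obtain g h where g: "g integrable_on cbox a b" and h: "h integrable_on cbox a b"
    and le: "\<And>x. x \<in> cbox a b \<Longrightarrow> norm (f x - g x) \<le> h x" and small: "integral (cbox a b) h < e / 6"
    using approx[OF e6] by blast
  obtain \<gamma>1 where \<gamma>1: "gauge \<gamma>1" "\<And>\<D>. \<D> tagged_division_of cbox a b \<Longrightarrow> \<gamma>1 fine \<D> \<Longrightarrow>
      norm ((\<Sum>(x, k)\<in>\<D>. measure lborel k *\<^sub>R g x) - integral (cbox a b) g) < e / 6"
    by (rule has_integralD[OF integrable_integral[OF g] e6]) blast
  obtain \<gamma>2 where \<gamma>2: "gauge \<gamma>2" "\<And>\<D>. \<D> tagged_division_of cbox a b \<Longrightarrow> \<gamma>2 fine \<D> \<Longrightarrow>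
      norm ((\<Sum>(x, k)\<in>\<D>. measure lborel k *\<^sub>R h x) - integral (cbox a b) h) < e / 6"
    by (rule has_integralD[OF integrable_integral[OF h] e6]) blast
  have *: "norm ((\<Sum>(x, k)\<in>\<D>. measure lborel k *\<^sub>R f x) - integral (cbox a b) g) < e / 2"
    if \<D>: "\<D> tagged_division_of cbox a b" "(\<lambda>x. \<gamma>1 x \<inter> \<gamma>2 x) fine \<D>" for \<D>
  proof -
    have fine: "\<gamma>1 fine \<D>" "\<gamma>2 fine \<D>"
      using \<D>(2) by (auto simp: fine_Int)
    have "(\<Sum>(x, k)\<in>\<D>. measure lborel k *\<^sub>R f x) - (\<Sum>(x, k)\<in>\<D>. measure lborel k *\<^sub>R g x)
        = (\<Sum>(x, k)\<in>\<D>. measure lborel k *\<^sub>R (f x - g x))"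
      by (simp add: sum_subtractf[symmetric] case_prod_unfold scaleR_diff_right)
    also have "norm \<dots> \<le> (\<Sum>(x, k)\<in>\<D>. measure lborel k *\<^sub>R h x)"
    proof (rule order_trans[OF norm_sum], rule sum_mono)
      fix p assume "p \<in> \<D>"
      then obtain x k where p: "p = (x, k)" "(x, k) \<in> \<D>"
        by (cases p) auto
      then have "x \<in> cbox a b"
        using tagged_division_ofD(2,3)[OF \<D>(1)] by blast
      then show "norm (case p of (x, k) \<Rightarrow> measure lborel k *\<^sub>R (f x - g x)) \<le> (case p of (x, k) \<Rightarrow> measure lborel k *\<^sub>R h x)"
        using le p by (simp add: mult_left_mono)
    qed
    also have "\<dots> < e / 6 + e / 6"
      using \<gamma>2(2)[OF \<D>(1) fine(2)] small unfolding real_norm_def by linarith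
    finally have "norm ((\<Sum>(x, k)\<in>\<D>. measure lborel k *\<^sub>R f x) - (\<Sum>(x, k)\<in>\<D>. measure lborel k *\<^sub>R g x)) < e / 6 + e / 6" .
    from norm_diff_triangle_less[OF this \<gamma>1(2)[OF \<D>(1) fine(1)]] show ?thesis
      by simp
  qed
  show "\<exists>\<gamma>. gauge \<gamma> \<and> (\<forall>\<D>1 \<D>2. \<D>1 tagged_division_of cbox a b \<and> \<gamma> fine \<D>1 \<and>
      \<D>2 tagged_division_of cbox a b \<and> \<gamma> fine \<D>2 \<longrightarrow>
      norm ((\<Sum>(x, k)\<in>\<D>1. measure lborel k *\<^sub>R f x) - (\<Sum>(x, k)\<in>\<D>2. measure lborel k *\<^sub>R f x)) < e)"
  proof (intro exI conjI allI impI)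
    show "gauge (\<lambda>x. \<gamma>1 x \<inter> \<gamma>2 x)"
      using \<gamma>1(1) \<gamma>2(1) by (rule gauge_Int)
    fix \<D>1 \<D>2
    assume "\<D>1 tagged_division_of cbox a b \<and> (\<lambda>x. \<gamma>1 x \<inter> \<gamma>2 x) fine \<D>1 \<and>
      \<D>2 tagged_division_of cbox a b \<and> (\<lambda>x. \<gamma>1 x \<inter> \<gamma>2 x) fine \<D>2"
    then show "norm ((\<Sum>(x, k)\<in>\<D>1. measure lborel k *\<^sub>R f x) - (\<Sum>(x, k)\<in>\<D>2. measure lborel k *\<^sub>R f x)) < e"
      by (elim conjE) (rule norm_triangle_half_l[OF * *])
  qed
qed

lemma measurable_on_continuous:
  assumes "continuous_on UNIV g" "S \<in> sets lebesgue"
  shows "g measurable_on S"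
  using measurable_on_restrict[OF continuous_imp_measurable_on[OF assms(1)] assms(2)]
  by (simp add: measurable_on_UNIV)

definition radial_trunc :: "real \<Rightarrow> 'b::real_normed_vector \<Rightarrow> 'b" where
  "radial_trunc k y = (k / max k (norm y)) *\<^sub>R y"

lemma norm_radial_trunc: "k > 0 \<Longrightarrow> norm (radial_trunc k y) \<le> k"
  by (simp add: radial_trunc_def divide_simps max_def)

lemma radial_trunc_eq: "k > 0 \<Longrightarrow> norm y \<le> k \<Longrightarrow> radial_trunc k y = y"
  by (simp add: radial_trunc_def max_def)

lemma norm_radial_trunc_diff: "k > 0 \<Longrightarrow> norm (radial_trunc k y - y) \<le> norm y"
proof -
  assume k: "k > 0"
  let ?c = "k / max k (norm y)"
  have "radial_trunc k y - y = (?c - 1) *\<^sub>R y"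
    by (simp add: radial_trunc_def algebra_simps)
  moreover have "\<bar>?c - 1\<bar> \<le> 1"
    using k by (auto simp: abs_le_iff max_def divide_simps)
  ultimately show ?thesis
    by (simp add: mult_left_le_one_le)
qed

lemma continuous_on_radial_trunc:
  assumes "k > 0"
  shows "continuous_on S (radial_trunc k :: 'b::real_normed_vector \<Rightarrow> 'b)"
  unfolding radial_trunc_def using assms by (intro continuous_intros) (auto simp: max_def)

lemma measurable_on_integral_tendsto_0:
  fixes e :: "nat \<Rightarrow> 'n::euclidean_space \<Rightarrow> real"
  assumes e: "\<And>n. e n measurable_on S" and S: "S \<in> sets lebesgue" and h: "h integrable_on S"
    and le: "\<And>n x. x \<in> S \<Longrightarrow> \<bar>e n x\<bar> \<le> h x" and lim: "\<And>x. x \<in> S \<Longrightarrow> (\<lambda>n. e n x) \<longlonglongrightarrow> 0"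
  shows "e n integrable_on S" "(\<lambda>n. integral S (e n)) \<longlonglongrightarrow> 0"
proof -
  show int: "e n integrable_on S" for n
    by (rule measurable_bounded_by_integrable_imp_integrable_real[OF _ h le S])
      (rule measurable_on_imp_borel_measurable_lebesgue[OF e S])
  show "(\<lambda>n. integral S (e n)) \<longlonglongrightarrow> 0"
    using dominated_convergence(2)[of e, OF int h, of "\<lambda>x. 0"] le lim by simp
qed

lemma integrable_on_measurable_bounded:
  fixes f :: "'n::euclidean_space \<Rightarrow> 'b::banach"
  assumes f: "f measurable_on cbox a b" and N0: "negligible N0"
    and le: "\<And>x. x \<in> cbox a b - N0 \<Longrightarrow> norm (f x) \<le> h x" and h: "h integrable_on cbox a b"
  shows "f integrable_on cbox a b"
proof -
  obtain N1 g where N1: "negligible N1" and g: "\<And>n. continuous_on UNIV (g n)"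
    and lim: "\<And>x. x \<notin> N1 \<Longrightarrow> (\<lambda>n. g n x) \<longlonglongrightarrow> (if x \<in> cbox a b then f x else 0)"
    using f unfolding measurable_on_def by blast
  define N where "N = N0 \<union> N1"
  have N: "negligible N"
    using N0 N1 by (simp add: N_def)
  define S where "S = cbox a b - N"
  have S: "S \<in> sets lebesgue"
    unfolding S_def using N by (simp add: negligible_imp_sets sets.Diff)
  have f_le: "norm (f x) \<le> h x" and f_lim: "(\<lambda>n. g n x) \<longlonglongrightarrow> f x" if "x \<in> S" for x
    using that le lim[of x] by (auto simp: S_def N_def)
  have fS: "f measurable_on S"
    by (rule measurable_on_spike_set[OF f])
      (use N in \<open>auto simp: S_def intro: negligible_subset\<close>)
  have hS: "h integrable_on S"
    by (rule integrable_spike_set[OF h]) (use N in \<open>auto simp: S_def intro: negligible_subset\<close>)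
  define f0 where "f0 x = (if x \<in> S then f x else 0)" for x
  have "f0 integrable_on cbox a b"
  proof (rule integrable_on_L1_approx)
    fix e :: real assume e: "e > 0"
    define e1 where "e1 k x = norm (radial_trunc (real (Suc k)) (f x) - f x)" for k x
    have e1_meas: "e1 k measurable_on S" for k
      unfolding e1_def
      using measurable_on_compose_continuous_0[OF fS, of "\<lambda>y. norm (radial_trunc (real (Suc k)) y - y)"]
      by (simp add: comp_def radial_trunc_def continuous_intros continuous_on_radial_trunc[unfolded radial_trunc_def])
    have e1_le: "\<bar>e1 k x\<bar> \<le> h x" if "x \<in> S" for k x
      using norm_radial_trunc_diff[of "real (Suc k)" "f x"] f_le[OF that] by (simp add: e1_def)
    have e1_lim: "(\<lambda>k. e1 k x) \<longlonglongrightarrow> 0" if "x \<in> S" for x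
    proof (rule tendsto_eventually)
      obtain k0 where "norm (f x) \<le> real k0"
        using real_arch_simple by blast
      then have "\<forall>k\<ge>k0. e1 k x = 0"
        by (auto simp: e1_def radial_trunc_eq)
      then show "eventually (\<lambda>k. e1 k x = 0) sequentially"
        unfolding eventually_sequentially by blast
    qed
    note e1 = measurable_on_integral_tendsto_0[OF e1_meas S hS e1_le e1_lim]
    have half: "0 < e / 2"
      using e by simp
    have "eventually (\<lambda>k. integral S (e1 k) < e / 2) sequentially"
      using order_tendstoD(2)[OF e1(2) half] .
    then obtain k where k: "integral S (e1 k) < e / 2"
      by (auto simp: eventually_sequentially)
    define c where "c = real (Suc k)"
    have c: "c > 0"
      by (simp add: c_def)
    define e2 where "e2 n x = norm (radial_trunc c (g n x) - radial_trunc c (f x))" for n x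
    have trunc_cont: "continuous_on A (\<lambda>x. radial_trunc c (v x))" if "continuous_on A v"
      for A :: "'t::topological_space set" and v :: "'t \<Rightarrow> 'b"
      using continuous_on_compose2[OF continuous_on_radial_trunc[OF c, of UNIV] that] by simp
    have e2_meas: "e2 n measurable_on S" for n
      unfolding e2_def
      by (rule measurable_on_combine[OF measurable_on_continuous[OF g S] fS,
            of "\<lambda>x y. norm (radial_trunc c x - radial_trunc c y)"])
        (auto intro!: continuous_intros trunc_cont simp: radial_trunc_def[of _ "0::'b"])
    have e2_le: "\<bar>e2 n x\<bar> \<le> 2 * c" for n x
      using norm_triangle_ineq4[of "radial_trunc c (g n x)" "radial_trunc c (f x)"]
        norm_radial_trunc[OF c, of "g n x"] norm_radial_trunc[OF c, of "f x"]
      by (simp add: e2_def)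
    have e2_lim: "(\<lambda>n. e2 n x) \<longlonglongrightarrow> 0" if "x \<in> S" for x
    proof -
      have "isCont (radial_trunc c) (f x)"
        using continuous_on_radial_trunc[OF c, of "UNIV :: 'b set"]
        by (simp add: continuous_on_eq_continuous_at)
      then have "(\<lambda>n. radial_trunc c (g n x)) \<longlonglongrightarrow> radial_trunc c (f x)"
        using f_lim[OF that] isCont_tendsto_compose by blast
      then show ?thesis
        unfolding e2_def by (intro tendsto_norm_zero) (simp add: LIM_zero)
    qed
    have const: "(\<lambda>x. 2 * c) integrable_on S"
      by (rule integrable_spike_set[OF integrable_const[of "2 * c" a b]])
        (use N in \<open>auto simp: S_def intro: negligible_subset\<close>)
    note e2 = measurable_on_integral_tendsto_0[OF e2_meas S const e2_le e2_lim]
    have "eventually (\<lambda>n. integral S (e2 n) < e / 2) sequentially"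
      using order_tendstoD(2)[OF e2(2) half] .
    then obtain n where n: "integral S (e2 n) < e / 2"
      by (auto simp: eventually_sequentially)
    define G where "G x = (if x \<in> S then radial_trunc c (g n x) else 0)" for x
    define h0 where "h0 x = (if x \<in> S then e1 k x + e2 n x else 0)" for x
    have SI: "S \<inter> cbox a b = S"
      by (auto simp: S_def)
    have intS: "(\<lambda>x. e1 k x + e2 n x) integrable_on S"
      by (intro integrable_add e1(1) e2(1))
    show "\<exists>g h. g integrable_on cbox a b \<and> h integrable_on cbox a b
      \<and> (\<forall>x\<in>cbox a b. norm (f0 x - g x) \<le> h x) \<and> integral (cbox a b) h < e"
    proof (intro exI conjI ballI)
      show "G integrable_on cbox a b"
      proof (rule integrable_spike[OF _ N])
        show "(\<lambda>x. radial_trunc c (g n x)) integrable_on cbox a b"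
          by (intro integrable_continuous trunc_cont continuous_on_subset[OF g]) simp
      qed (simp add: G_def S_def)
      show "h0 integrable_on cbox a b"
        unfolding h0_def integrable_restrict_Int SI by (rule intS)
      show "integral (cbox a b) h0 < e"
      proof -
        have "integral (cbox a b) h0 = integral S (e1 k) + integral S (e2 n)"
          unfolding h0_def integral_restrict_Int SI by (rule integral_add[OF e1(1) e2(1)])
        also have "\<dots> < e / 2 + e / 2"
          by (rule add_strict_mono[OF k n])
        finally show ?thesis
          by simp
      qed
      show "norm (f0 x - G x) \<le> h0 x" for x
      proof (cases "x \<in> S")
        case True
        have "norm (f x - radial_trunc c (g n x))
            \<le> norm (f x - radial_trunc c (f x)) + norm (radial_trunc c (f x) - radial_trunc c (g n x))"
          using dist_triangle[of "f x" _ "radial_trunc c (f x)"] by (simp add: dist_norm)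
        also have "\<dots> = e1 k x + e2 n x"
          by (simp add: e1_def e2_def c_def norm_minus_commute[of "f x"]
              norm_minus_commute[of _ "radial_trunc _ (g n x)"])
        finally show ?thesis
          using True by (simp add: f0_def G_def h0_def)
      qed (simp add: f0_def G_def h0_def)
    qed
  qed
  then show ?thesis
    by (rule integrable_spike[OF _ N]) (simp add: f0_def S_def)
qed

lemma measurable_on_continuous_half_open:
  fixes F :: "real \<Rightarrow> 'b::real_normed_vector"
  assumes F: "continuous_on {a..<b} F"
  shows "F measurable_on {a..b}"
proof (cases "a < b")
  case False
  have "negligible {a..b}"
    using False by (intro negligible_subset[OF negligible_sing[of a]]) auto
  then show ?thesis
    unfolding measurable_on_def by (intro exI[of _ "{a..b}"] exI[of _ "\<lambda>n x. 0"]) simp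
next
  case True
  define q where "q n x = max a (min x (b - (b - a) / real (Suc n)))" for n x
  define c where "c n x = max 0 (1 - real (Suc n) * \<bar>x - max a (min x b)\<bar>)" for n x
  have q_mem: "q n x \<in> {a..<b}" for n x
  proof -
    have "b - (b - a) / real (Suc n) < b"
      using True by simp
    then have "min x (b - (b - a) / real (Suc n)) < b"
      by (rule min.strict_coboundedI2)
    then show ?thesis
      using True by (simp add: q_def)
  qed
  have "continuous_on UNIV (\<lambda>x. F (q n x))" for n
  proof (rule continuous_on_compose2[OF F])
    show "continuous_on UNIV (q n)"
      unfolding q_def by (intro continuous_intros)
  qed (use q_mem in auto)
  moreover have "(\<lambda>n. F (q n x)) \<longlonglongrightarrow> F x" if "x \<in> {a..<b}" for x
  proof (rule tendsto_eventually)
    have "(\<lambda>n. b - (b - a) / real (Suc n)) \<longlonglongrightarrow> b - 0"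
      by (intro tendsto_intros LIMSEQ_Suc lim_const_over_n)
    then have "eventually (\<lambda>n. x < b - (b - a) / real (Suc n)) sequentially"
      by (rule order_tendstoD) (use that in simp)
    then show "eventually (\<lambda>n. F (q n x) = F x) sequentially"
      by eventually_elim (use that in \<open>simp add: q_def\<close>)
  qed
  moreover have "continuous_on UNIV (c n)" for n
    unfolding c_def by (intro continuous_intros)
  moreover have "(\<lambda>n. c n x *\<^sub>R F (q n x)) \<longlonglongrightarrow> 0" if "x \<notin> {a..b}" for x
  proof (rule tendsto_eventually)
    have "\<bar>x - max a (min x b)\<bar> > 0"
      using that True by auto
    then obtain k where k: "1 < real k * \<bar>x - max a (min x b)\<bar>"
      using reals_Archimedean3 by blast
    have "c n x = 0" if "n \<ge> k" for n
    proof -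
      have "real k * \<bar>x - max a (min x b)\<bar> \<le> real (Suc n) * \<bar>x - max a (min x b)\<bar>"
        using that by (intro mult_right_mono) auto
      then show ?thesis
        using k by (simp add: c_def)
    qed
    then show "eventually (\<lambda>n. c n x *\<^sub>R F (q n x) = 0) sequentially"
      unfolding eventually_sequentially by (metis scaleR_zero_left)
  qed
  moreover have "c n x = 1" if "x \<in> {a..b}" for n x
    using that by (simp add: c_def)
  ultimately show ?thesis
    unfolding measurable_on_def
    by (intro exI[of _ "{b}"] exI[of _ "\<lambda>n x. c n x *\<^sub>R F (q n x)"])
      (auto intro!: continuous_intros)
qed

lemma integrable_on_finite_nn_integral:
  fixes f :: "real \<Rightarrow> real"
  assumes f: "f measurable_on {s..T}" and nonneg: "\<And>r. 0 \<le> f r"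
    and fin: "(\<integral>\<^sup>+ r \<in> {s..T}. ennreal (f r) \<partial>lebesgue) < \<infinity>"
  shows "f integrable_on {s..T}"
proof -
  define F where "F r = (if r \<in> {s..T} then f r else 0)" for r
  have F_meas: "F \<in> borel_measurable lebesgue"
    unfolding F_def by (rule measurable_on_imp_borel_measurable_lebesgue_UNIV) (simp only: measurable_on_UNIV f)
  have F_eq: "(\<integral>\<^sup>+ r \<in> {s..T}. ennreal (f r) \<partial>lebesgue) = integral\<^sup>N lebesgue F"
    by (rule nn_integral_cong) (auto simp: F_def indicator_def)
  with fin obtain i where i: "integral\<^sup>N lebesgue F = ennreal i" "0 \<le> i"
    by (cases "integral\<^sup>N lebesgue F") auto
  have "(F has_integral i) UNIV"
    using has_integral_iff_nn_integral_lebesgue[of F i] F_meas i nonneg by (simp add: F_def)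
  then show "f integrable_on {s..T}"
    unfolding F_def has_integral_restrict_UNIV by blast
qed

lemma nn_integral_tail_tendsto_0:
  fixes f :: "real \<Rightarrow> real"
  assumes int: "f integrable_on {s..T}" and nonneg: "\<And>r. 0 \<le> f r" and sT: "s < T"
  shows "((\<lambda>t. \<integral>\<^sup>+ r \<in> {t..T}. ennreal (f r) \<partial>lebesgue) \<longlongrightarrow> 0) (at_left T)"
proof -
  have eq: "(\<integral>\<^sup>+ r \<in> {t..T}. ennreal (f r) \<partial>lebesgue) = ennreal (integral {t..T} f)" if "s \<le> t" for t
  proof -
    have "f integrable_on {t..T}"
      by (rule integrable_on_subinterval[OF int]) (use that in auto)
    from nn_integral_has_integral_lebesgue'[OF nonneg integrable_integral[OF this]]
    show ?thesis
      by (simp add: nn_integral_completion)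
  qed
  have "continuous_on {s..T} (\<lambda>t. integral {t..T} f)"
    by (rule indefinite_integral_continuous_1'[OF int])
  then have "((\<lambda>t. integral {t..T} f) \<longlongrightarrow> integral {T..T} f) (at T within {s..T})"
    unfolding continuous_on_def by (rule bspec) (use sT in simp)
  then have "((\<lambda>t. integral {t..T} f) \<longlongrightarrow> 0) (at_left T)"
    using sT by (simp add: at_within_Icc_at_left)
  then have "((\<lambda>t. ennreal (integral {t..T} f)) \<longlongrightarrow> ennreal 0) (at_left T)"
    by (rule tendsto_ennrealI)
  moreover have "eventually (\<lambda>t. ennreal (integral {t..T} f) = (\<integral>\<^sup>+ r \<in> {t..T}. ennreal (f r) \<partial>lebesgue)) (at_left T)"
    using eventually_at_left_real[OF sT] by eventually_elim (simp add: eq)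
  ultimately show "((\<lambda>t. \<integral>\<^sup>+ r \<in> {t..T}. ennreal (f r) \<partial>lebesgue) \<longlongrightarrow> 0) (at_left T)"
    unfolding ennreal_0 by (rule Lim_transform_eventually)
qed


section \<open>The control system\<close>

lemma measurable_on_subset:
  assumes "u measurable_on S" "S' \<subseteq> S" "S' \<in> sets lebesgue"
  shows "u measurable_on S'"
proof -
  have "(\<lambda>x. if x \<in> S' then (if x \<in> S then u x else 0) else 0) measurable_on UNIV"
    by (rule measurable_on_restrict) (use assms in \<open>simp_all add: measurable_on_UNIV\<close>)
  also have "(\<lambda>x. if x \<in> S' then (if x \<in> S then u x else 0) else 0) = (\<lambda>x. if x \<in> S' then u x else 0)"
    by (rule ext) (use assms(2) in auto)
  finally show ?thesis
    by (simp only: measurable_on_UNIV)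
qed

lemma L2_space_mono:
  assumes "u \<in> L2_space s T" "s \<le> t"
  shows "u \<in> L2_space t T"
proof -
  have "(\<integral>\<^sup>+ r \<in> {t..T}. ennreal ((norm (u r))\<^sup>2) \<partial>lebesgue)
      \<le> (\<integral>\<^sup>+ r \<in> {s..T}. ennreal ((norm (u r))\<^sup>2) \<partial>lebesgue)"
    using assms(2) by (intro nn_integral_mono) (auto simp: indicator_def)
  then show ?thesis
    using assms measurable_on_subset[of u "{s..T}" "{t..T}"] by (auto simp: L2_space_def)
qed

lemma measurable_on_norm_power2: "u measurable_on S \<Longrightarrow> (\<lambda>r. (norm (u r))\<^sup>2) measurable_on S"
  using measurable_on_compose_continuous_0[of u S "\<lambda>y. (norm y)\<^sup>2"]
  by (simp add: comp_def continuous_intros)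

lemma L2_space_integrable: "u \<in> L2_space s T \<Longrightarrow> (\<lambda>r. (norm (u r))\<^sup>2) integrable_on {s..T}"
  by (rule integrable_on_finite_nn_integral) (auto simp: L2_space_def measurable_on_norm_power2)

lemma measurable_on_blinfun_apply:
  fixes F :: "'n::euclidean_space \<Rightarrow> 'a::real_normed_vector \<Rightarrow>\<^sub>L 'b::real_normed_vector"
  assumes "F measurable_on S" "u measurable_on S"
  shows "(\<lambda>r. F r (u r)) measurable_on S"
  by (rule measurable_on_combine[OF assms, of "\<lambda>B x. blinfun_apply B x"])
    (auto intro!: continuous_intros)

lemma integrable_on_powr_reflected:
  assumes "a > -1" "s \<le> t"
  shows "(\<lambda>q. (t - q) powr a) integrable_on {s..t::real}"
proof -
  have "(\<lambda>x. x powr a) integrable_on cbox 0 (t - s)"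
    using integrable_on_powr_from_0[of a "t - s"] assms by simp
  from integrable_affinity[OF this, of "-1" t]
  have "(\<lambda>q. (t - q) powr a) integrable_on (\<lambda>x. t - x) ` {0..t - s}"
    by simp
  moreover have "(\<lambda>x. t - x) ` {0..t - s} = {s..t}"
    using assms(2) by (auto intro!: image_eqI[of _ _ "t - x" for x])
  ultimately show ?thesis
    by simp
qed

lemma continuous_on_holder:
  assumes "holder_on T \<delta> f" "0 < \<delta>"
  shows "continuous_on {0..T} f"
  unfolding continuous_on_def
proof
  fix t assume t: "t \<in> {0..T}"
  obtain C where C: "\<And>r q. r \<in> {0..T} \<Longrightarrow> q \<in> {0..T} \<Longrightarrow> norm (f q - f r) \<le> C * \<bar>q - r\<bar> powr \<delta>"
    using assms(1) unfolding holder_on_def by blast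
  have "((\<lambda>r. f r - f t) \<longlongrightarrow> 0) (at t within {0..T})"
  proof (rule Lim_null_comparison)
    show "eventually (\<lambda>r. norm (f r - f t) \<le> C * \<bar>r - t\<bar> powr \<delta>) (at t within {0..T})"
      using C[OF t] by (auto simp: eventually_at_filter)
    have "((\<lambda>r. \<bar>r - t\<bar> powr \<delta>) \<longlongrightarrow> 0) (at t within {0..T})"
      by (rule tendsto_zero_powrI[of _ _ _ \<delta>])
        (use assms(2) in \<open>auto intro!: tendsto_eq_intros\<close>)
    then show "((\<lambda>r. C * \<bar>r - t\<bar> powr \<delta>) \<longlongrightarrow> 0) (at t within {0..T})"
      by (rule tendsto_mult_right_zero)
  qed
  then show "(f \<longlongrightarrow> f t) (at t within {0..T})"
    by (simp add: LIM_zero_cancel)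
qed

lemma holder_on_bounded:
  assumes "holder_on T \<delta> f" "0 < \<delta>"
  obtains K where "0 \<le> K" "\<And>t. t \<in> {0..T} \<Longrightarrow> norm (f t) \<le> K"
proof -
  have "bounded (f ` {0..T})"
    by (intro compact_imp_bounded compact_continuous_image continuous_on_holder[OF assms]) simp
  then show ?thesis
    using that unfolding bounded_pos by (metis image_eqI less_imp_le)
qed

locale control_system =
  fixes T \<theta> \<delta> \<alpha> :: real
    and A :: "real \<Rightarrow> ('h::complex_hilbert, 'h) oper"
    and E :: "real \<Rightarrow> real \<Rightarrow> 'h \<Rightarrow>\<^sub>L 'h"
    and G :: "real \<Rightarrow> 'u::complex_hilbert \<Rightarrow>\<^sub>L 'h"
  assumes T: "0 < T" and \<delta>: "0 < \<delta>" and H1: "H1 T \<theta> A" and H3: "H3 T A E" and H4: "H4 T \<delta> A E"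
    and H5: "H5 T \<delta> \<alpha> A G"
begin

lemma alpha: "0 < \<alpha>" "\<alpha> < 1 / 2" "1 - \<alpha> \<in> {0..1}"
  using H5 \<delta> unfolding H5_def by auto

lemma clinear_E: "0 \<le> s \<Longrightarrow> s \<le> t \<Longrightarrow> t \<le> T \<Longrightarrow> clinear_op (E t s)"
  using H3 unfolding H3_def evolution_operator_def by blast

lemma E_compose: "0 \<le> s \<Longrightarrow> s \<le> r \<Longrightarrow> r \<le> t \<Longrightarrow> t \<le> T \<Longrightarrow> E t r o\<^sub>L E r s = E t s"
  using H3 unfolding H3_def evolution_operator_def by blast

lemma E_compose_apply: "0 \<le> s \<Longrightarrow> s \<le> r \<Longrightarrow> r \<le> t \<Longrightarrow> t \<le> T \<Longrightarrow> E t r (E r s x) = E t s x"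
  by (metis E_compose blinfun_apply_blinfun_compose)

lemma E_refl: "0 \<le> t \<Longrightarrow> t \<le> T \<Longrightarrow> E t t x = x"
  using H3 unfolding H3_def evolution_operator_def by simp

lemma E_continuous: "continuous_on {(t, s). 0 \<le> s \<and> s \<le> t \<and> t \<le> T} (\<lambda>(t, s). E t s x)"
  using H3 unfolding H3_def evolution_operator_def by blast

lemma E_bounded_on_vector:
  obtains K where "\<And>t s. 0 \<le> s \<Longrightarrow> s \<le> t \<Longrightarrow> t \<le> T \<Longrightarrow> norm (E t s x) \<le> K"
proof -
  let ?D = "{(t, s). 0 \<le> s \<and> s \<le> t \<and> t \<le> T}"
  have "closed ?D"
    unfolding case_prod_unfold by (intro closed_Collect_conj closed_Collect_le continuous_intros)
  moreover have "bounded ?D"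
    by (rule bounded_subset[OF bounded_cbox[of "(0, 0)" "(T, T)"]]) (auto simp: cbox_Pair_eq)
  ultimately have "compact ?D"
    by (simp add: compact_eq_bounded_closed)
  then have "bounded ((\<lambda>(t, s). E t s x) ` ?D)"
    by (intro compact_imp_bounded compact_continuous_image E_continuous)
  then obtain K where "\<And>v. v \<in> (\<lambda>(t, s). E t s x) ` ?D \<Longrightarrow> norm v \<le> K"
    unfolding bounded_iff by blast
  then show ?thesis
    using that[of K] by force
qed

lemma E_tendsto_final: "((\<lambda>t. E T t x) \<longlongrightarrow> x) (at_left T)"
proof -
  have "continuous_on {0..T} (\<lambda>t. E T t x)"
    using continuous_on_compose2[OF E_continuous, of "{0..T}" "\<lambda>t. (T, t)" x]
    by (simp add: continuous_intros image_subset_iff)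
  then have "((\<lambda>t. E T t x) \<longlongrightarrow> E T T x) (at T within {0..T})"
    unfolding continuous_on_def by (rule bspec) (use T in simp)
  then show ?thesis
    using T by (simp add: at_within_Icc_at_left E_refl)
qed

definition W :: "real \<Rightarrow> real \<Rightarrow> 'h \<Rightarrow>\<^sub>L 'h" where
  "W t q = bop (bgraph (badj (E t q)) O pos_pow (oper_adj (A q)) (1 - \<alpha>))"

definition D :: "real \<Rightarrow> 'u \<Rightarrow>\<^sub>L 'h" where
  "D q = bop (frac_G A G \<alpha> q)"

lemma EAG_eq: "EAG A E G \<alpha> t q = - (badj (W t q) o\<^sub>L D q)"
  by (simp add: EAG_def W_def D_def)

lemma frac_evol_adj_0: "frac_evol_adj A E (1 - \<alpha>) 0 t q = bgraph (badj (E t q)) O pos_pow (oper_adj (A q)) (1 - \<alpha>)"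
  by (simp add: frac_evol_adj_def neg_pow_def)

lemma
  assumes "0 \<le> q" "q < t" "t \<le> T"
  shows W_graph: "bgraph (badj (E t q)) O pos_pow (oper_adj (A q)) (1 - \<alpha>) = bgraph (W t q)"
    and clinear_W: "clinear_op (W t q)"
proof -
  have "bounded_oper (frac_evol_adj A E (1 - \<alpha>) 0 t q)"
    using bspec[OF bspec[OF conjunct2[OF H3[unfolded H3_def]] alpha(3)], of 0] assms by auto
  from bounded_operD[OF this] show "bgraph (badj (E t q)) O pos_pow (oper_adj (A q)) (1 - \<alpha>) = bgraph (W t q)"
    "clinear_op (W t q)"
    by (simp_all add: frac_evol_adj_0 W_def)
qed

lemma frac_evol_adj_bound:
  assumes "\<gamma> \<in> {0..1}"
  obtains K where "\<And>t q. 0 \<le> q \<Longrightarrow> q < t \<Longrightarrow> t \<le> T \<Longrightarrow>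
    norm (bop (frac_evol_adj A E (1 - \<alpha>) \<gamma> t q)) \<le> K * (1 + (t - q) powr (\<gamma> - (1 - \<alpha>)))"
proof -
  obtain K where K: "\<And>q t. 0 \<le> q \<and> q < t \<and> t \<le> T \<Longrightarrow>
      norm (bop (frac_evol A E (1 - \<alpha>) \<gamma> t q)) + norm (bop (frac_evol_adj A E (1 - \<alpha>) \<gamma> t q))
        \<le> K * (1 + (t - q) powr (\<gamma> - (1 - \<alpha>)))"
    using bspec[OF bspec[OF conjunct2[OF H3[unfolded H3_def]] alpha(3)] assms] by blast
  show ?thesis
  proof (rule that[of K])
    fix t q :: real assume "0 \<le> q" "q < t" "t \<le> T"
    then show "norm (bop (frac_evol_adj A E (1 - \<alpha>) \<gamma> t q)) \<le> K * (1 + (t - q) powr (\<gamma> - (1 - \<alpha>)))"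
      using K[of q t] norm_ge_zero[of "bop (frac_evol A E (1 - \<alpha>) \<gamma> t q)"] by linarith
  qed
qed

lemma W_bound:
  obtains K where "0 \<le> K" "\<And>t q. 0 \<le> q \<Longrightarrow> q < t \<Longrightarrow> t \<le> T \<Longrightarrow> norm (W t q) \<le> K * (1 + (t - q) powr (\<alpha> - 1))"
proof -
  obtain K where K: "\<And>t q. 0 \<le> q \<Longrightarrow> q < t \<Longrightarrow> t \<le> T \<Longrightarrow>
    norm (bop (frac_evol_adj A E (1 - \<alpha>) 0 t q)) \<le> K * (1 + (t - q) powr (0 - (1 - \<alpha>)))"
    by (rule frac_evol_adj_bound[of 0]) auto
  show ?thesis
  proof (rule that[of "max K 0"])
    fix t q :: real assume "0 \<le> q" "q < t" "t \<le> T"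
    then have "norm (W t q) \<le> K * (1 + (t - q) powr (\<alpha> - 1))"
      using K[of q t] by (simp add: W_def frac_evol_adj_0)
    also have "\<dots> \<le> max K 0 * (1 + (t - q) powr (\<alpha> - 1))"
      by (intro mult_right_mono) auto
    finally show "norm (W t q) \<le> max K 0 * (1 + (t - q) powr (\<alpha> - 1))" .
  qed simp
qed

lemma W_continuous:
  assumes "0 < t" "t \<le> T"
  shows "continuous_on {0..<t} (W t)"
  unfolding continuous_on_def
proof
  fix p assume p: "p \<in> {0..<t}"
  obtain C where "\<forall>s \<sigma> t. 0 \<le> s \<and> s \<le> \<sigma> \<and> \<sigma> < t \<and> t \<le> T \<longrightarrow>
      norm (bop (frac_evol_adj A E (1 - \<alpha>) 0 t \<sigma>) - bop (frac_evol_adj A E (1 - \<alpha>) 0 t s))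
        \<le> C * (\<sigma> - s) powr \<delta> * (1 + (t - \<sigma>) powr (0 - (1 - \<alpha>) - \<delta>))"
    using bspec[OF bspec[OF H4[unfolded H4_def] alpha(3)], of 0]
    by (elim meta_impE) (simp, blast)
  then have C: "norm (W t \<sigma> - W t s) \<le> C * (\<sigma> - s) powr \<delta> * (1 + (t - \<sigma>) powr (\<alpha> - 1 - \<delta>))"
    if "0 \<le> s" "s \<le> \<sigma>" "\<sigma> < t" for s \<sigma>
    using that assms(2) by (simp add: W_def frac_evol_adj_0)
  let ?b = "\<lambda>q. C * \<bar>q - p\<bar> powr \<delta> * (1 + (t - max q p) powr (\<alpha> - 1 - \<delta>))"
  have "((\<lambda>q. W t q - W t p) \<longlongrightarrow> 0) (at p within {0..<t})"
  proof (rule Lim_null_comparison)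
    show "eventually (\<lambda>q. norm (W t q - W t p) \<le> ?b q) (at p within {0..<t})"
      unfolding eventually_at_filter
    proof (intro always_eventually allI impI)
      fix q assume "q \<in> {0..<t}"
      then show "norm (W t q - W t p) \<le> ?b q"
        using C[of p q] C[of q p] p by (cases "p \<le> q") (auto simp: max_def norm_minus_commute)
    qed
    have "((\<lambda>q. \<bar>q - p\<bar> powr \<delta>) \<longlongrightarrow> 0) (at p within {0..<t})"
      by (rule tendsto_zero_powrI[of _ _ _ \<delta>]) (use \<delta> in \<open>auto intro!: tendsto_eq_intros\<close>)
    moreover have "((\<lambda>q. (t - max q p) powr (\<alpha> - 1 - \<delta>)) \<longlongrightarrow> (t - max p p) powr (\<alpha> - 1 - \<delta>)) (at p within {0..<t})"
      by (intro tendsto_powr tendsto_diff tendsto_max tendsto_const tendsto_ident_at) (use p in auto)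
    ultimately have "(?b \<longlongrightarrow> C * 0 * (1 + (t - max p p) powr (\<alpha> - 1 - \<delta>))) (at p within {0..<t})"
      by (intro tendsto_mult tendsto_add tendsto_const)
    then show "(?b \<longlongrightarrow> 0) (at p within {0..<t})"
      by simp
  qed
  then show "(W t \<longlongrightarrow> W t p) (at p within {0..<t})"
    by (simp add: LIM_zero_cancel)
qed

lemma W_compose:
  assumes "0 \<le> q" "q < t" "t \<le> r" "r \<le> T"
  shows "W r q = W t q o\<^sub>L badj (E r t)"
proof -
  have "badj (E r q) = badj (E t q) o\<^sub>L badj (E r t)"
    using assms by (simp add: clinear_E flip: E_compose[of q t r] badj_compose)
  then have "bgraph (badj (E r q)) = bgraph (badj (E r t)) O bgraph (badj (E t q))"
    by (simp add: bgraph_relcomp)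
  then have "bgraph (badj (E r q)) O pos_pow (oper_adj (A q)) (1 - \<alpha>) = bgraph (badj (E r t)) O bgraph (W t q)"
    using assms by (simp add: O_assoc W_graph)
  then show ?thesis
    by (simp add: W_def[of r] bgraph_relcomp)
qed

lemma EAG_compose:
  assumes "0 \<le> q" "q < t" "t \<le> r" "r \<le> T"
  shows "EAG A E G \<alpha> r q = E r t o\<^sub>L EAG A E G \<alpha> t q"
proof -
  have "badj (W r q) = E r t o\<^sub>L badj (W t q)"
    using assms by (simp add: W_compose[OF assms] badj_compose badj_badj clinear_W clinear_E)
  then show ?thesis
    by (intro blinfun_eqI) (simp add: EAG_eq blinfun.minus_left blinfun.minus_right)
qed

lemma D_holder: "holder_on T \<delta> D"
  using H5 unfolding H5_def D_def by simp

lemma EAG_continuous: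
  assumes "0 < t" "t \<le> T"
  shows "continuous_on {0..<t} (EAG A E G \<alpha> t)"
proof -
  have "continuous_on {0..<t} (\<lambda>q. badj (W t q))"
    by (rule continuous_on_badj[OF W_continuous]) (use assms clinear_W in auto)
  moreover have "continuous_on {0..<t} D"
    by (rule continuous_on_subset[OF continuous_on_holder[OF D_holder \<delta>]]) (use assms in auto)
  ultimately have "continuous_on {0..<t} (\<lambda>q. - (badj (W t q) o\<^sub>L D q))"
    by (intro continuous_intros)
  then show ?thesis
    by (simp add: EAG_eq)
qed

lemma EAG_bound:
  obtains K where "0 \<le> K" "\<And>t q. 0 \<le> q \<Longrightarrow> q < t \<Longrightarrow> t \<le> T \<Longrightarrow>
    norm (EAG A E G \<alpha> t q) \<le> K * (1 + (t - q) powr (\<alpha> - 1))"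
proof -
  obtain K1 where K1: "0 \<le> K1" "\<And>t q. 0 \<le> q \<Longrightarrow> q < t \<Longrightarrow> t \<le> T \<Longrightarrow>
      norm (W t q) \<le> K1 * (1 + (t - q) powr (\<alpha> - 1))"
    using W_bound by blast
  obtain K2 where K2: "0 \<le> K2" "\<And>t. t \<in> {0..T} \<Longrightarrow> norm (D t) \<le> K2"
    using holder_on_bounded[OF D_holder \<delta>] by blast
  show ?thesis
  proof (rule that[of "K1 * K2"])
    fix t q :: real assume *: "0 \<le> q" "q < t" "t \<le> T"
    have "norm (EAG A E G \<alpha> t q) \<le> norm (badj (W t q)) * norm (D q)"
      by (simp add: EAG_eq norm_blinfun_compose)
    also have "\<dots> \<le> (K1 * (1 + (t - q) powr (\<alpha> - 1))) * K2"
      by (intro mult_mono order_trans[OF norm_badj_le] K1 K2 clinear_W) (use * K1 in auto)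
    finally show "norm (EAG A E G \<alpha> t q) \<le> K1 * K2 * (1 + (t - q) powr (\<alpha> - 1))"
      by (simp add: mult_ac)
  qed (use K1 K2 in simp)
qed

definition R :: "'h \<Rightarrow>\<^sub>L 'h" where
  "R = bop ((A T)\<inverse>)"

lemma
  shows R_graph: "(A T)\<inverse> = bgraph R" and clinear_R: "clinear_op R"
proof -
  have "bounded_oper ((shifted 0 (A T))\<inverse>)"
    using H1 T unfolding H1_def resolvent_set_def by simp
  then obtain B where B: "clinear_op B" "(shifted 0 (A T))\<inverse> = bgraph B"
    unfolding bounded_oper_def by blast
  have "(y, x) \<in> (shifted 0 (A T))\<inverse> \<longleftrightarrow> (- y, x) \<in> (A T)\<inverse>" for x y
  proof -
    have "0 *\<^sub>C x = (0::'h)" for x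
      using scaleR_eq_scaleC[of 0 x] by simp
    then have "(x, y) \<in> shifted 0 (A T) \<longleftrightarrow> (\<exists>z. (x, z) \<in> A T \<and> y = - z)"
      by (auto simp: shifted_def)
    also have "\<dots> \<longleftrightarrow> (x, - y) \<in> A T"
      by (metis add.inverse_inverse)
    finally show ?thesis
      by simp
  qed
  then have "(y, x) \<in> (A T)\<inverse> \<longleftrightarrow> (y, x) \<in> bgraph (- B)" for x y
    by (metis B(2) add.inverse_inverse bgraph_iff blinfun.minus_left blinfun.minus_right)
  then have eq: "(A T)\<inverse> = bgraph (- B)"
    by (intro set_eqI) (metis surj_pair)
  then show "(A T)\<inverse> = bgraph R" "clinear_op R"
    using B(1) by (auto simp: R_def)
qed

lemma A_final_iff: "(x, y) \<in> A T \<longleftrightarrow> x = R y"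
  by (metis R_graph bgraph_iff converse_iff)

lemma R_inj: "R y = R z \<Longrightarrow> y = z"
  using H1 T A_final_iff unfolding H1_def closed_oper_def linear_oper_def
  by (metis atLeastAtMost_iff less_imp_le order_refl single_valuedD)

lemma LsT_eq: "LsT_int T A E G \<alpha> s u = R w \<Longrightarrow> LsT T A E G \<alpha> s u = - w"
  unfolding LsT_def oper_apply_def A_final_iff by (auto dest: R_inj)

lemma LsT_int_eq: "LsT_int T A E G \<alpha> s u = integral {s..T} (\<lambda>r. R (EAG A E G \<alpha> T r (u r)))"
  by (simp add: LsT_int_def R_def)

lemma LsT_dom_iff: "u \<in> LsT_dom T A E G \<alpha> s \<longleftrightarrow> u \<in> L2_space s T \<and> (\<exists>w. LsT_int T A E G \<alpha> s u = R w)"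
  by (auto simp: LsT_dom_def Domain_iff A_final_iff)

lemma frac_evol_adj_1:
  assumes "0 \<le> q" "q < T"
  shows "frac_evol_adj A E (1 - \<alpha>) 1 T q = bgraph (- (W T q o\<^sub>L badj R))"
proof -
  have "(oper_adj (A T))\<inverse> = bgraph (badj R)"
    by (metis R_graph bgraph_badj clinear_R oper_adj_converse)
  then have adj: "(x, y) \<in> oper_adj (A T) \<longleftrightarrow> x = badj R y" for x y
    by (metis bgraph_iff converse_iff)
  have "0 *\<^sub>C x = (0::'h)" for x
    using scaleR_eq_scaleC[of 0 x] by simp
  then have "(y, x) \<in> (shifted 0 (oper_adj (A T)))\<inverse> \<longleftrightarrow> (\<exists>z. y = - z \<and> x = badj R z)" for x y
    by (auto simp: shifted_def adj)
  then have "(y, x) \<in> (shifted 0 (oper_adj (A T)))\<inverse> \<longleftrightarrow> (y, x) \<in> bgraph (- badj R)" for x y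
    by (auto simp: bgraph_iff blinfun.minus_left blinfun.minus_right intro: exI[of _ "- y"])
  then have "(shifted 0 (oper_adj (A T)))\<inverse> = bgraph (- badj R)"
    by (intro set_eqI) (metis surj_pair)
  then have "frac_evol_adj A E (1 - \<alpha>) 1 T q = bgraph (- badj R) O bgraph (W T q)"
    using assms by (simp add: frac_evol_adj_def neg_pow_def W_graph)
  also have "\<dots> = bgraph (- (W T q o\<^sub>L badj R))"
    unfolding bgraph_relcomp
    by (rule arg_cong[of _ _ bgraph], rule blinfun_eqI) (simp add: blinfun.minus_left blinfun.minus_right)
  finally show ?thesis .
qed

lemma R_EAG_bound:
  obtains K where "0 \<le> K" "\<And>q. 0 \<le> q \<Longrightarrow> q < T \<Longrightarrow> norm (R o\<^sub>L EAG A E G \<alpha> T q) \<le> K"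
proof -
  obtain K1 where K1: "\<And>t q. 0 \<le> q \<Longrightarrow> q < t \<Longrightarrow> t \<le> T \<Longrightarrow>
    norm (bop (frac_evol_adj A E (1 - \<alpha>) 1 t q)) \<le> K1 * (1 + (t - q) powr (1 - (1 - \<alpha>)))"
    by (rule frac_evol_adj_bound[of 1]) auto
  obtain K2 where K2: "0 \<le> K2" "\<And>t. t \<in> {0..T} \<Longrightarrow> norm (D t) \<le> K2"
    using holder_on_bounded[OF D_holder \<delta>] by blast
  let ?K = "\<bar>K1\<bar> * (1 + T powr \<alpha>)"
  show ?thesis
  proof (rule that[of "?K * K2"])
    show "0 \<le> ?K * K2"
      using K2(1) by simp
    fix q :: real assume q: "0 \<le> q" "q < T"
    have W: "clinear_op (W T q)"
      using q by (simp add: clinear_W)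
    have "R o\<^sub>L badj (W T q) = badj (W T q o\<^sub>L badj R)"
      by (simp add: badj_compose badj_badj W clinear_R)
    then have "norm (R o\<^sub>L badj (W T q)) \<le> norm (W T q o\<^sub>L badj R)"
      using norm_badj_le[of "W T q o\<^sub>L badj R"] by (simp add: W clinear_R)
    also have "\<dots> = norm (bop (frac_evol_adj A E (1 - \<alpha>) 1 T q))"
      by (simp add: frac_evol_adj_1[OF q])
    also have "\<dots> \<le> K1 * (1 + (T - q) powr \<alpha>)"
      using K1[of q T] q by simp
    also have "\<dots> \<le> ?K"
      by (intro mult_mono add_left_mono powr_mono2) (use q alpha in auto)
    finally have RW: "norm (R o\<^sub>L badj (W T q)) \<le> ?K" .
    have "R o\<^sub>L EAG A E G \<alpha> T q = - ((R o\<^sub>L badj (W T q)) o\<^sub>L D q)"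
      by (intro blinfun_eqI) (simp add: EAG_eq blinfun.minus_left blinfun.minus_right)
    then have "norm (R o\<^sub>L EAG A E G \<alpha> T q) \<le> norm (R o\<^sub>L badj (W T q)) * norm (D q)"
      by (simp add: norm_blinfun_compose)
    also have "\<dots> \<le> ?K * K2"
      by (intro mult_mono RW K2) (use q in auto)
    finally show "norm (R o\<^sub>L EAG A E G \<alpha> T q) \<le> ?K * K2" .
  qed
qed

lemma EAG_integrable:
  assumes st: "0 \<le> s" "s < t" "t \<le> T" and u: "u measurable_on {s..t}"
    and Z: "negligible Z" "\<And>q. q \<in> {s..t} - Z \<Longrightarrow> norm (u q) \<le> C"
  shows "(\<lambda>q. EAG A E G \<alpha> t q (u q)) integrable_on {s..t}"
proof -
  obtain K where K: "0 \<le> K" "\<And>t q. 0 \<le> q \<Longrightarrow> q < t \<Longrightarrow> t \<le> T \<Longrightarrow>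
    norm (EAG A E G \<alpha> t q) \<le> K * (1 + (t - q) powr (\<alpha> - 1))"
    using EAG_bound by blast
  let ?h = "\<lambda>q. (K * C) * (1 + (t - q) powr (\<alpha> - 1))"
  have "(\<lambda>q. EAG A E G \<alpha> t q (u q)) integrable_on cbox s t"
  proof (rule integrable_on_measurable_bounded)
    have "continuous_on {s..<t} (EAG A E G \<alpha> t)"
      by (rule continuous_on_subset[OF EAG_continuous]) (use st in auto)
    then show "(\<lambda>q. EAG A E G \<alpha> t q (u q)) measurable_on cbox s t"
      using measurable_on_blinfun_apply[OF measurable_on_continuous_half_open u] by simp
    show "negligible (insert t Z)"
      using Z(1) by simp
    show "norm (EAG A E G \<alpha> t q (u q)) \<le> ?h q" if "q \<in> cbox s t - insert t Z" for q
    proof -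
      have q: "q \<in> {s..t} - Z" "q < t"
        using that by auto
      have "norm (EAG A E G \<alpha> t q (u q)) \<le> norm (EAG A E G \<alpha> t q) * norm (u q)"
        by (rule norm_blinfun)
      also have "\<dots> \<le> (K * (1 + (t - q) powr (\<alpha> - 1))) * C"
        by (intro mult_mono K Z q) (use q st K in auto)
      finally show ?thesis
        by (simp add: mult_ac)
    qed
    have "(\<lambda>q. (t - q) powr (\<alpha> - 1)) integrable_on {s..t}"
      by (rule integrable_on_powr_reflected) (use st alpha in auto)
    then show "?h integrable_on cbox s t"
      by (intro integrable_on_mult_right integrable_add) auto
  qed
  then show ?thesis
    by simp
qed

lemma R_EAG_integrable:
  assumes t: "0 \<le> t" "t < T" and u: "u \<in> L2_space t T"
  shows "(\<lambda>q. R (EAG A E G \<alpha> T q (u q))) integrable_on {t..T}"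
proof -
  obtain K where K: "0 \<le> K" "\<And>q. 0 \<le> q \<Longrightarrow> q < T \<Longrightarrow> norm (R o\<^sub>L EAG A E G \<alpha> T q) \<le> K"
    using R_EAG_bound by blast
  let ?h = "\<lambda>q. K * (1 + (norm (u q))\<^sup>2)"
  have "(\<lambda>q. (R o\<^sub>L EAG A E G \<alpha> T q) (u q)) integrable_on cbox t T"
  proof (rule integrable_on_measurable_bounded)
    have "continuous_on {t..<T} (EAG A E G \<alpha> T)"
      by (rule continuous_on_subset[OF EAG_continuous]) (use t T in auto)
    then have "continuous_on {t..<T} (\<lambda>q. R o\<^sub>L EAG A E G \<alpha> T q)"
      by (intro continuous_intros)
    moreover have "u measurable_on {t..T}"
      using u by (simp add: L2_space_def)
    ultimately show "(\<lambda>q. (R o\<^sub>L EAG A E G \<alpha> T q) (u q)) measurable_on cbox t T"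
      unfolding cbox_interval
      by (intro measurable_on_blinfun_apply[OF measurable_on_continuous_half_open])
    show "norm ((R o\<^sub>L EAG A E G \<alpha> T q) (u q)) \<le> ?h q" if "q \<in> cbox t T - {T}" for q
    proof -
      have "norm ((R o\<^sub>L EAG A E G \<alpha> T q) (u q)) \<le> norm (R o\<^sub>L EAG A E G \<alpha> T q) * norm (u q)"
        by (rule norm_blinfun)
      also have "\<dots> \<le> K * (1 + (norm (u q))\<^sup>2)"
      proof (intro mult_mono K)
        have "0 \<le> (norm (u q) - 1)\<^sup>2 + (norm (u q))\<^sup>2 + 1"
          by simp
        then show "norm (u q) \<le> 1 + (norm (u q))\<^sup>2"
          using zero_le_power2[of "norm (u q) - 1"] norm_ge_zero[of "u q"]
          unfolding power2_diff by simp
      qed (use that t K in auto)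
      finally show ?thesis .
    qed
    have "(\<lambda>q. (norm (u q))\<^sup>2) integrable_on {t..T}"
      by (rule L2_space_integrable[OF u])
    then show "?h integrable_on cbox t T"
      by (intro integrable_on_mult_right integrable_add) auto
  qed simp
  then show ?thesis
    by simp
qed

lemma integral_EAG_compose:
  assumes st: "0 \<le> s" "t \<le> r" "r \<le> T" and int: "(\<lambda>q. EAG A E G \<alpha> t q (u q)) integrable_on {s..t}"
  shows "((\<lambda>q. EAG A E G \<alpha> r q (u q)) has_integral - E r t (Ls A E G \<alpha> s u t)) {s..t}"
proof (rule has_integral_spike)
  show "((\<lambda>q. E r t (EAG A E G \<alpha> t q (u q))) has_integral - E r t (Ls A E G \<alpha> s u t)) {s..t}"
    using has_integral_linear[OF integrable_integral[OF int] blinfun.bounded_linear_right[of "E r t"]]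
    by (simp add: comp_def Ls_def blinfun.minus_right)
  show "EAG A E G \<alpha> r q (u q) = E r t (EAG A E G \<alpha> t q (u q))" if "q \<in> {s..t} - {t}" for q
    using that st by (simp add: EAG_compose[of q t r])
qed simp

lemma Ls_split:
  assumes st: "0 \<le> s" "s < t" "t < r" "r \<le> T"
    and int: "(\<lambda>q. EAG A E G \<alpha> t q (u q)) integrable_on {s..t}"
      "(\<lambda>q. EAG A E G \<alpha> r q (u q)) integrable_on {t..r}"
  shows "Ls A E G \<alpha> s u r = E r t (Ls A E G \<alpha> s u t) + Ls A E G \<alpha> t u r"
proof -
  have "((\<lambda>q. EAG A E G \<alpha> r q (u q)) has_integral
      - E r t (Ls A E G \<alpha> s u t) + integral {t..r} (\<lambda>q. EAG A E G \<alpha> r q (u q))) {s..r}"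
    by (rule has_integral_combine[OF _ _ integral_EAG_compose integrable_integral])
      (use st int in auto)
  then show ?thesis
    by (simp add: Ls_def integral_unique)
qed

lemma LsT_split:
  assumes st: "0 \<le> s" "s < t" "t < T" and u: "u \<in> LsT_dom T A E G \<alpha> s"
    and int: "(\<lambda>q. EAG A E G \<alpha> t q (u q)) integrable_on {s..t}"
  shows "u \<in> LsT_dom T A E G \<alpha> t"
    and "LsT T A E G \<alpha> s u = E T t (Ls A E G \<alpha> s u t) + LsT T A E G \<alpha> t u"
proof -
  have L2: "u \<in> L2_space t T"
    using u st L2_space_mono[of u s T t] by (simp add: LsT_dom_def)
  obtain w where w: "LsT_int T A E G \<alpha> s u = R w"
    using u by (auto simp: LsT_dom_iff)
  have "((\<lambda>q. R (EAG A E G \<alpha> T q (u q))) has_integral R (- E T t (Ls A E G \<alpha> s u t))) {s..t}"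
    using has_integral_linear[OF integral_EAG_compose[OF _ _ _ int] blinfun.bounded_linear_right[of R], of T] st
    by (simp add: comp_def)
  moreover have "((\<lambda>q. R (EAG A E G \<alpha> T q (u q))) has_integral LsT_int T A E G \<alpha> t u) {t..T}"
    unfolding LsT_int_eq by (rule integrable_integral[OF R_EAG_integrable]) (use st L2 in auto)
  ultimately have "((\<lambda>q. R (EAG A E G \<alpha> T q (u q))) has_integral
      R (- E T t (Ls A E G \<alpha> s u t)) + LsT_int T A E G \<alpha> t u) {s..T}"
    by (rule has_integral_combine[rotated 2]) (use st in auto)
  then have "R w = R (- E T t (Ls A E G \<alpha> s u t)) + LsT_int T A E G \<alpha> t u"
    unfolding w[symmetric] LsT_int_eq[of s] by (rule integral_unique)
  then have t: "LsT_int T A E G \<alpha> t u = R (w + E T t (Ls A E G \<alpha> s u t))"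
    by (simp add: blinfun.add_right blinfun.minus_right algebra_simps)
  then show "u \<in> LsT_dom T A E G \<alpha> t"
    using L2 by (auto simp: LsT_dom_iff)
  show "LsT T A E G \<alpha> s u = E T t (Ls A E G \<alpha> s u t) + LsT T A E G \<alpha> t u"
    by (simp add: LsT_eq[OF w] LsT_eq[OF t])
qed

end


section \<open>The optimal state\<close>

lemma AE_lebesgue_negligibleE:
  assumes "AE r in lebesgue. Q r"
  obtains Z where "negligible Z" "\<And>r. r \<notin> Z \<Longrightarrow> Q r"
proof -
  from assms obtain Z where "{r \<in> space lebesgue. \<not> Q r} \<subseteq> Z" "emeasure lebesgue Z = 0" "Z \<in> sets lebesgue"
    by (rule AE_E)
  then show ?thesis
    by (intro that[of Z]) (auto simp: negligible_iff_null_sets null_sets_def)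
qed

lemma continuous_on_extend_right:
  fixes g :: "real \<Rightarrow> 'a::topological_space"
  assumes g: "continuous_on {s..<T} g" and lim: "(g \<longlongrightarrow> l) (at_left T)"
  shows "continuous_on {s..T} (\<lambda>t. if t < T then g t else l)"
  unfolding continuous_on_def
proof
  fix t assume t: "t \<in> {s..T}"
  show "((\<lambda>t. if t < T then g t else l) \<longlongrightarrow> (if t < T then g t else l)) (at t within {s..T})"
  proof (cases "t < T")
    case True
    have "at t within {s..T} = at t within {s..<T}"
      by (rule at_within_nhd[of t "{..<T}"]) (use True in auto)
    moreover have "(g \<longlongrightarrow> g t) (at t within {s..<T})"
      using g t True by (simp add: continuous_on_def)
    moreover have "eventually (\<lambda>r. g r = (if r < T then g r else l)) (at t within {s..<T})"
      by (simp add: eventually_at_filter)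
    ultimately show ?thesis
      using True by (auto intro: Lim_transform_eventually)
  next
    case False
    then have [simp]: "t = T"
      using t by simp
    have "(g \<longlongrightarrow> l) (at T within {s..T} - {T})"
      by (rule tendsto_within_subset[OF lim]) auto
    then have "(g \<longlongrightarrow> l) (at T within {s..T})"
      by (simp add: at_within_def)
    moreover have "eventually (\<lambda>r. g r = (if r < T then g r else l)) (at T within {s..T})"
      by (auto simp: eventually_at_filter)
    ultimately show ?thesis
      by (auto intro: Lim_transform_eventually)
  qed
qed

locale riccati_system = control_system T \<theta> \<delta> \<alpha> A E G
  for T \<theta> \<delta> \<alpha> :: real
    and A :: "real \<Rightarrow> ('h::complex_hilbert, 'h) oper"
    and E :: "real \<Rightarrow> real \<Rightarrow> 'h \<Rightarrow>\<^sub>L 'h"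
    and G :: "real \<Rightarrow> 'u::complex_hilbert \<Rightarrow>\<^sub>L 'h" +
  fixes M :: "real \<Rightarrow> 'h \<Rightarrow>\<^sub>L 'h"
    and N :: "real \<Rightarrow> 'u \<Rightarrow>\<^sub>L 'u"
    and PT :: "'h \<Rightarrow>\<^sub>L 'h"
    and P :: "real \<Rightarrow> 'h \<Rightarrow>\<^sub>L 'h"
  assumes H6: "H6 T \<delta> M N" and PT: "PT \<in> Sigma_plus"
    and optimal_pairs: "optimal_pairs_known T A E G \<alpha> M N PT"
    and riccati: "riccati_operator T A E G \<alpha> M N PT P"
    and riccati_facts: "riccati_known T A E G \<alpha> M N PT P"
begin

lemma M_Sigma_plus: "r \<in> {0..T} \<Longrightarrow> M r \<in> Sigma_plus"
  and N_Sigma_plus: "r \<in> {0..T} \<Longrightarrow> N r \<in> Sigma_plus"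
  and M_holder: "holder_on T \<delta> M" and N_holder: "holder_on T \<delta> N"
  using H6 unfolding H6_def by auto

lemma P_Sigma_plus: "t \<in> {0..<T} \<Longrightarrow> P t \<in> Sigma_plus"
  using riccati unfolding riccati_operator_def by blast

lemma P_bounded: "bounded (P ` {0..<T})"
  and P_continuous: "continuous_on {0..<T} P"
  and P_tendsto: "((\<lambda>t. P t x) \<longlongrightarrow> PT x) (at_left T)"
  using riccati_facts unfolding riccati_known_def by blast+

lemma N_inverse_bound:
  obtains \<nu> where "0 < \<nu>" "\<And>t v. t \<in> {0..T} \<Longrightarrow> norm (bop ((bgraph (N t))\<inverse>) v) \<le> norm v / \<nu>"
proof -
  obtain \<nu> where \<nu>: "\<nu> > 0" "\<And>t u. t \<in> {0..T} \<Longrightarrow> \<nu> * (norm u)\<^sup>2 \<le> inner (N t u) u"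
    using H6 unfolding H6_def inner_eq_Re_cinner by blast
  show ?thesis
    by (rule that[OF \<nu>(1)]) (rule norm_coercive_inverse_le[OF N_Sigma_plus \<nu>])
qed

lemma
  assumes "0 \<le> s" "s < T" "optimal_control T A E G \<alpha> M N PT s x u"
  shows optimal_in_dom: "u \<in> LsT_dom T A E G \<alpha> s"
    and optimal_state_continuous: "continuous_on {s..<T} (state A E G \<alpha> s x u)"
  using optimal_pairs assms unfolding optimal_pairs_known_def by auto

lemma optimal_in_L2: "optimal_control T A E G \<alpha> M N PT s x u \<Longrightarrow> u \<in> L2_space s T"
  by (simp add: optimal_control_def)

lemma optimal_cost:
  assumes "0 \<le> s" "s < T" "optimal_control T A E G \<alpha> M N PT s x u"
  shows "cost T A E G \<alpha> M N PT s x u = ennreal ((norm (sqrt_op (P s) x))\<^sup>2)"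
  using riccati assms P_Sigma_plus[of s]
  unfolding riccati_operator_def by (simp add: norm_sqrt_op_apply inner_eq_Re_cinner)

lemma value_le_cost:
  assumes "0 \<le> t" "t < T" "v \<in> L2_space t T"
  shows "ennreal ((norm (sqrt_op (P t) w))\<^sup>2) \<le> cost T A E G \<alpha> M N PT t w v"
proof -
  have "t \<in> {0..<T}"
    using assms by simp
  then obtain u where u: "optimal_control T A E G \<alpha> M N PT t w u"
    using optimal_pairs unfolding optimal_pairs_known_def by blast
  then show ?thesis
    using assms unfolding optimal_cost[OF assms(1,2) u, symmetric] by (simp add: optimal_control_def)
qed

lemma feedback_operator_bound:
  assumes "t < T"
  obtains K where "0 \<le> K" "\<And>q. 0 \<le> q \<Longrightarrow> q \<le> t \<Longrightarrow> norm (GAB A G \<alpha> q (P q)) \<le> K"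
proof -
  obtain c where c: "\<And>q. q \<in> {0..<T} \<Longrightarrow>
      norm (bop (bgraph (P q) O pos_pow (oper_adj (A q)) (1 - \<alpha>))) \<le> c * (T - q) powr (\<alpha> - 1)"
    using riccati_facts unfolding riccati_known_def by blast
  obtain K where K: "0 \<le> K" "\<And>t. t \<in> {0..T} \<Longrightarrow> norm (D t) \<le> K"
    using holder_on_bounded[OF D_holder \<delta>] by blast
  show ?thesis
  proof (rule that[of "K * (\<bar>c\<bar> * (T - t) powr (\<alpha> - 1))"])
    show "0 \<le> K * (\<bar>c\<bar> * (T - t) powr (\<alpha> - 1))"
      using K(1) by simp
    fix q assume q: "0 \<le> q" "q \<le> t"
    have "bounded_oper (frac_G A G \<alpha> q)"
      using H5 q assms unfolding H5_def by simp
    then have "clinear_op (D q)"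
      unfolding D_def by (rule bounded_operD)
    then have D: "norm (badj (D q)) \<le> K"
      using norm_badj_le[of "D q"] K(2)[of q] q assms by simp
    have "norm (bop (bgraph (P q) O pos_pow (oper_adj (A q)) (1 - \<alpha>))) \<le> c * (T - q) powr (\<alpha> - 1)"
      using c q assms by simp
    also have "\<dots> \<le> \<bar>c\<bar> * (T - t) powr (\<alpha> - 1)"
      by (intro mult_mono powr_mono2') (use q assms alpha in auto)
    finally have B: "norm (bop (bgraph (P q) O pos_pow (oper_adj (A q)) (1 - \<alpha>))) \<le> \<bar>c\<bar> * (T - t) powr (\<alpha> - 1)" .
    have "norm (GAB A G \<alpha> q (P q)) \<le> norm (badj (D q)) * norm (bop (bgraph (P q) O pos_pow (oper_adj (A q)) (1 - \<alpha>)))"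
      by (simp add: GAB_def D_def norm_blinfun_compose)
    also have "\<dots> \<le> K * (\<bar>c\<bar> * (T - t) powr (\<alpha> - 1))"
      by (intro mult_mono D B K(1)) simp
    finally show "norm (GAB A G \<alpha> q (P q)) \<le> K * (\<bar>c\<bar> * (T - t) powr (\<alpha> - 1))" .
  qed
qed

lemma optimal_locally_bounded:
  assumes s: "0 \<le> s" "s < T" and u: "optimal_control T A E G \<alpha> M N PT s x u" and t: "t < T"
  obtains C Z where "negligible Z" "\<And>q. q \<in> {s..t} - Z \<Longrightarrow> norm (u q) \<le> C"
proof -
  let ?y = "state A E G \<alpha> s x u"
  have "AE q in lebesgue. q \<in> {s..<T} \<longrightarrow> u q = bop ((bgraph (N q))\<inverse>) (GAB A G \<alpha> q (P q) (?y q))"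
    using riccati_facts s u unfolding riccati_known_def by auto
  then obtain Z where Z: "negligible Z"
    "\<And>q. q \<notin> Z \<Longrightarrow> q \<in> {s..<T} \<longrightarrow> u q = bop ((bgraph (N q))\<inverse>) (GAB A G \<alpha> q (P q) (?y q))"
    by (rule AE_lebesgue_negligibleE) blast
  have "continuous_on {s..t} ?y"
    by (rule continuous_on_subset[OF optimal_state_continuous[OF s u]]) (use t in auto)
  then have "bounded (?y ` {s..t})"
    by (intro compact_imp_bounded compact_continuous_image compact_Icc)
  then obtain Ky where Ky: "\<And>q. q \<in> {s..t} \<Longrightarrow> norm (?y q) \<le> Ky"
    unfolding bounded_iff by blast
  obtain \<nu> where \<nu>: "0 < \<nu>" "\<And>t v. t \<in> {0..T} \<Longrightarrow> norm (bop ((bgraph (N t))\<inverse>) v) \<le> norm v / \<nu>"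
    using N_inverse_bound by blast
  obtain K where K: "0 \<le> K" "\<And>q. 0 \<le> q \<Longrightarrow> q \<le> t \<Longrightarrow> norm (GAB A G \<alpha> q (P q)) \<le> K"
    using feedback_operator_bound[OF t] by blast
  show ?thesis
  proof (rule that[OF Z(1)])
    fix q assume q: "q \<in> {s..t} - Z"
    have "norm (u q) \<le> norm (GAB A G \<alpha> q (P q) (?y q)) / \<nu>"
      using Z(2)[of q] \<nu>(2)[of q] q s t by auto
    also have "\<dots> \<le> (K * Ky) / \<nu>"
      by (intro divide_right_mono order_trans[OF norm_blinfun] mult_mono K Ky) (use q s \<nu>(1) K(1) in auto)
    finally show "norm (u q) \<le> K * Ky / \<nu>" .
  qed
qed

lemma optimal_tail:
  assumes s: "0 \<le> s" "s < T" and u: "optimal_control T A E G \<alpha> M N PT s x u"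
    and t: "s < t" "t < T"
  defines "y \<equiv> state A E G \<alpha> s x u" and "\<eta> \<equiv> E T s x + LsT T A E G \<alpha> s u"
  shows "u \<in> LsT_dom T A E G \<alpha> t"
    and "t \<le> r \<Longrightarrow> r < T \<Longrightarrow> state A E G \<alpha> t (y t - \<eta>) u r = y r - E r t \<eta>"
    and "final_value T A E G \<alpha> PT t (y t - \<eta>) u = sqrt_op PT (\<eta> - E T t \<eta>)"
proof -
  have dom: "u \<in> LsT_dom T A E G \<alpha> s"
    by (rule optimal_in_dom[OF s u])
  have int: "(\<lambda>q. EAG A E G \<alpha> r q (u q)) integrable_on {a..r}" if "s \<le> a" "a < r" "r < T" for a r
  proof -
    obtain C Z where Z: "negligible Z" "\<And>q. q \<in> {s..r} - Z \<Longrightarrow> norm (u q) \<le> C"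
      using optimal_locally_bounded[OF s u \<open>r < T\<close>] by blast
    have "u measurable_on {a..r}"
      by (rule measurable_on_subset[of u "{s..T}"]) (use optimal_in_L2[OF u] that in \<open>auto simp: L2_space_def\<close>)
    then show ?thesis
      by (rule EAG_integrable[where Z = Z and C = C, rotated 3]) (use Z that s in auto)
  qed
  have int_t: "(\<lambda>q. EAG A E G \<alpha> t q (u q)) integrable_on {s..t}"
    using int t by simp
  show "u \<in> LsT_dom T A E G \<alpha> t"
    by (rule LsT_split[OF s(1) t dom int_t])
  show "state A E G \<alpha> t (y t - \<eta>) u r = y r - E r t \<eta>" if r: "t \<le> r" "r < T"
  proof (cases "r = t")
    case True
    then show ?thesis
      using s t by (simp add: state_def Ls_def E_refl)
  next
    case False
    then have "Ls A E G \<alpha> s u r = E r t (Ls A E G \<alpha> s u t) + Ls A E G \<alpha> t u r"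
      by (intro Ls_split int_t int) (use s t r in auto)
    then show ?thesis
      using s t r by (simp add: y_def state_def blinfun.add_right blinfun.diff_right E_compose_apply)
  qed
  have "E T t (y t - \<eta>) + LsT T A E G \<alpha> t u = \<eta> - E T t \<eta>"
    using LsT_split(2)[OF s(1) t dom int_t] s t
    by (simp add: y_def \<eta>_def state_def blinfun.add_right blinfun.diff_right E_compose_apply)
  then show "final_value T A E G \<alpha> PT t (y t - \<eta>) u = sqrt_op PT (\<eta> - E T t \<eta>)"
    by (simp add: final_value_def flip: blinfun.add_right)
qed

lemma sqrt_P_shifted_state_tendsto_0:
  assumes s: "0 \<le> s" "s < T" and u: "optimal_control T A E G \<alpha> M N PT s x u"
  defines "y \<equiv> state A E G \<alpha> s x u" and "\<eta> \<equiv> E T s x + LsT T A E G \<alpha> s u"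
  shows "((\<lambda>t. sqrt_op (P t) (y t - \<eta>)) \<longlongrightarrow> 0) (at_left T)"
proof -
  obtain KM where KM: "0 \<le> KM" "\<And>r. r \<in> {0..T} \<Longrightarrow> norm (M r) \<le> KM"
    using holder_on_bounded[OF M_holder \<delta>] by blast
  obtain KN where KN: "0 \<le> KN" "\<And>r. r \<in> {0..T} \<Longrightarrow> norm (N r) \<le> KN"
    using holder_on_bounded[OF N_holder \<delta>] by blast
  obtain KE where KE: "\<And>r t. 0 \<le> t \<Longrightarrow> t \<le> r \<Longrightarrow> r \<le> T \<Longrightarrow> norm (E r t \<eta>) \<le> KE"
    using E_bounded_on_vector[of \<eta>] by blast
  define a where "a r = (norm (sqrt_op (M r) (y r)))\<^sup>2" for r
  define f1 where "f1 r = 2 * a r + 2 * (KM * KE\<^sup>2)" for r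
  define f2 where "f2 r = KN * (norm (u r))\<^sup>2" for r
  let ?b = "\<lambda>t. (\<integral>\<^sup>+ r \<in> {t..T}. ennreal (f1 r) \<partial>lebesgue) + (\<integral>\<^sup>+ r \<in> {t..T}. ennreal (f2 r) \<partial>lebesgue)
    + ennreal ((norm (sqrt_op PT (\<eta> - E T t \<eta>)))\<^sup>2)"
  have "a integrable_on {s..T}"
  proof (rule integrable_on_finite_nn_integral)
    have "continuous_on {s..<T} (\<lambda>r. sqrt_op (M r) (y r))"
    proof (rule continuous_on_sqrt_op_apply)
      show "continuous_on {s..<T} M"
        by (rule continuous_on_subset[OF continuous_on_holder[OF M_holder \<delta>]]) (use s in auto)
      show "M ` {s..<T} \<subseteq> Sigma_plus"
        using M_Sigma_plus s by auto
      show "continuous_on {s..<T} y"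
        unfolding y_def by (rule optimal_state_continuous[OF s u])
    qed
    then have "continuous_on {s..<T} a"
      unfolding a_def by (intro continuous_on_power continuous_on_norm)
    then show "a measurable_on {s..T}"
      by (rule measurable_on_continuous_half_open)
    have "(\<integral>\<^sup>+ r \<in> {s..T}. ennreal (a r) \<partial>lebesgue) \<le> cost T A E G \<alpha> M N PT s x u"
      using optimal_in_dom[OF s u] by (simp add: cost_def a_def y_def add.assoc)
    also have "\<dots> < \<infinity>"
      by (simp add: optimal_cost[OF s u])
    finally show "(\<integral>\<^sup>+ r \<in> {s..T}. ennreal (a r) \<partial>lebesgue) < \<infinity>" .
  qed (simp add: a_def)
  then have f1: "f1 integrable_on {s..T}"
    unfolding f1_def by (intro integrable_add integrable_on_mult_right integrable_const_ivl)
  have f2: "f2 integrable_on {s..T}"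
    unfolding f2_def by (intro integrable_on_mult_right L2_space_integrable optimal_in_L2[OF u])
  have nonneg: "0 \<le> f1 r" "0 \<le> f2 r" for r
    using KM(1) KN(1) by (simp_all add: f1_def f2_def a_def)
  have "(?b \<longlongrightarrow> 0 + 0 + ennreal ((norm (sqrt_op PT (\<eta> - \<eta>)))\<^sup>2)) (at_left T)"
    by (intro tendsto_add nn_integral_tail_tendsto_0[OF f1 nonneg(1) s(2)]
        nn_integral_tail_tendsto_0[OF f2 nonneg(2) s(2)] tendsto_ennrealI tendsto_power tendsto_norm
        blinfun.tendsto tendsto_diff tendsto_const E_tendsto_final)
  then have b_lim: "(?b \<longlongrightarrow> 0) (at_left T)"
    by simp
  have bound: "ennreal ((norm (sqrt_op (P t) (y t - \<eta>)))\<^sup>2) \<le> ?b t" if t: "s < t" "t < T" for t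
  proof -
    note tail = optimal_tail[OF s u t, folded y_def \<eta>_def]
    have "ennreal ((norm (sqrt_op (P t) (y t - \<eta>)))\<^sup>2) \<le> cost T A E G \<alpha> M N PT t (y t - \<eta>) u"
      by (rule value_le_cost) (use s t L2_space_mono[OF optimal_in_L2[OF u], of t] in auto)
    also have "\<dots> = (\<integral>\<^sup>+ r \<in> {t..T}. ennreal ((norm (sqrt_op (M r) (state A E G \<alpha> t (y t - \<eta>) u r)))\<^sup>2) \<partial>lebesgue)
        + (\<integral>\<^sup>+ r \<in> {t..T}. ennreal ((norm (sqrt_op (N r) (u r)))\<^sup>2) \<partial>lebesgue)
        + ennreal ((norm (sqrt_op PT (\<eta> - E T t \<eta>)))\<^sup>2)"
      using tail(1) by (simp add: cost_def tail(3))
    also have "\<dots> \<le> ?b t"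
    proof (intro add_mono order_refl)
      show "(\<integral>\<^sup>+ r \<in> {t..T}. ennreal ((norm (sqrt_op (N r) (u r)))\<^sup>2) \<partial>lebesgue)
          \<le> (\<integral>\<^sup>+ r \<in> {t..T}. ennreal (f2 r) \<partial>lebesgue)"
      proof (rule nn_integral_mono)
        fix r
        show "ennreal ((norm (sqrt_op (N r) (u r)))\<^sup>2) * indicator {t..T} r \<le> ennreal (f2 r) * indicator {t..T} r"
          using norm_sqrt_op_apply_le[OF N_Sigma_plus KN(2), of r "u r"] s t
          by (auto simp: indicator_def f2_def intro!: ennreal_leI)
      qed
      have "AE r in lebesgue. r \<noteq> T"
        by (rule AE_I'[of "{T}"]) (auto simp flip: negligible_iff_null_sets)
      then show "(\<integral>\<^sup>+ r \<in> {t..T}. ennreal ((norm (sqrt_op (M r) (state A E G \<alpha> t (y t - \<eta>) u r)))\<^sup>2) \<partial>lebesgue)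
          \<le> (\<integral>\<^sup>+ r \<in> {t..T}. ennreal (f1 r) \<partial>lebesgue)"
      proof (intro nn_integral_mono_AE, eventually_elim)
        fix r assume "r \<noteq> T"
        show "ennreal ((norm (sqrt_op (M r) (state A E G \<alpha> t (y t - \<eta>) u r)))\<^sup>2) * indicator {t..T} r
          \<le> ennreal (f1 r) * indicator {t..T} r"
        proof (cases "r \<in> {t..T}")
          case True
          then have r: "t \<le> r" "r < T" "r \<in> {0..T}"
            using \<open>r \<noteq> T\<close> s t by auto
          have "(norm (sqrt_op (M r) (E r t \<eta>)))\<^sup>2 \<le> KM * (norm (E r t \<eta>))\<^sup>2"
            by (rule norm_sqrt_op_apply_le[OF M_Sigma_plus[OF r(3)] KM(2)[OF r(3)]])
          also have "\<dots> \<le> KM * KE\<^sup>2"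
            by (intro mult_left_mono power_mono KE KM(1)) (use r s t in auto)
          finally have ME: "(norm (sqrt_op (M r) (E r t \<eta>)))\<^sup>2 \<le> KM * KE\<^sup>2" .
          have "(norm (v - w))\<^sup>2 \<le> 2 * (norm v)\<^sup>2 + 2 * (norm w)\<^sup>2" for v w :: 'h
          proof -
            have "(norm (v - w))\<^sup>2 + (norm (v + w))\<^sup>2 = 2 * (norm v)\<^sup>2 + 2 * (norm w)\<^sup>2"
              by (simp add: power2_norm_eq_inner inner_diff_left inner_diff_right inner_add_left
                  inner_add_right inner_commute)
            then show ?thesis
              using zero_le_power2[of "norm (v + w)"] by linarith
          qed
          from this[of "sqrt_op (M r) (y r)" "sqrt_op (M r) (E r t \<eta>)"] ME
          have "(norm (sqrt_op (M r) (y r - E r t \<eta>)))\<^sup>2 \<le> f1 r"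
            by (simp add: f1_def a_def blinfun.diff_right)
          then show ?thesis
            using True by (simp add: tail(2)[OF r(1,2)] ennreal_leI)
        qed simp
      qed
    qed
    finally show ?thesis .
  qed
  have "((\<lambda>t. ennreal ((norm (sqrt_op (P t) (y t - \<eta>)))\<^sup>2)) \<longlongrightarrow> 0) (at_left T)"
  proof (rule tendsto_sandwich[OF _ _ tendsto_const b_lim])
    show "eventually (\<lambda>t. ennreal ((norm (sqrt_op (P t) (y t - \<eta>)))\<^sup>2) \<le> ?b t) (at_left T)"
      using eventually_at_left_real[OF s(2)] by eventually_elim (use bound in auto)
  qed simp
  then have "((\<lambda>t. (norm (sqrt_op (P t) (y t - \<eta>)))\<^sup>2) \<longlongrightarrow> 0) (at_left T)"
    by (simp add: tendsto_ennreal_iff flip: ennreal_0)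
  then have "((\<lambda>t. sqrt ((norm (sqrt_op (P t) (y t - \<eta>)))\<^sup>2)) \<longlongrightarrow> sqrt 0) (at_left T)"
    by (rule tendsto_real_sqrt)
  then show ?thesis
    by (simp add: tendsto_norm_zero_iff)
qed

lemma sqrt_P_apply_tendsto: "((\<lambda>t. sqrt_op (P t) z) \<longlongrightarrow> sqrt_op PT z) (at_left T)"
proof -
  obtain c where c: "\<And>t. t \<in> {0..<T} \<Longrightarrow> norm (P t) \<le> c"
    using P_bounded unfolding bounded_iff by blast
  have ev: "eventually (\<lambda>t. t \<in> {0..<T}) (at_left T)"
    using eventually_at_left_real[OF T] by eventually_elim auto
  show ?thesis
    by (rule sqrt_op_apply_tendsto_strong[OF P_tendsto eventually_mono[OF ev c]
          eventually_mono[OF ev P_Sigma_plus] PT])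
qed

lemma continuous_on_sqrt_P_state:
  assumes s: "0 \<le> s" "s < T" and u: "optimal_control T A E G \<alpha> M N PT s x u"
  shows "continuous_on {s..T} (\<lambda>t. if t < T then sqrt_op (P t) (state A E G \<alpha> s x u t)
    else final_value T A E G \<alpha> PT s x u)"
proof (rule continuous_on_extend_right)
  show "continuous_on {s..<T} (\<lambda>t. sqrt_op (P t) (state A E G \<alpha> s x u t))"
  proof (rule continuous_on_sqrt_op_apply)
    show "continuous_on {s..<T} P"
      by (rule continuous_on_subset[OF P_continuous]) (use s in auto)
  qed (use P_Sigma_plus s optimal_state_continuous[OF s u] in auto)
  let ?\<eta> = "E T s x + LsT T A E G \<alpha> s u"
  have "((\<lambda>t. sqrt_op (P t) (state A E G \<alpha> s x u t - ?\<eta>) + sqrt_op (P t) ?\<eta>) \<longlongrightarrow> 0 + sqrt_op PT ?\<eta>) (at_left T)"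
    by (intro tendsto_add sqrt_P_shifted_state_tendsto_0[OF s u] sqrt_P_apply_tendsto)
  then show "((\<lambda>t. sqrt_op (P t) (state A E G \<alpha> s x u t)) \<longlongrightarrow> final_value T A E G \<alpha> PT s x u) (at_left T)"
    by (simp add: final_value_def blinfun.add_right blinfun.diff_right)
qed

end


theorem theorem1p10:
  fixes T \<theta> \<rho> \<mu> \<delta> \<alpha> :: real
    and A :: "real \<Rightarrow> ('h::complex_hilbert, 'h) oper"
    and E :: "real \<Rightarrow> real \<Rightarrow> 'h \<Rightarrow>\<^sub>L 'h"
    and G :: "real \<Rightarrow> 'u::complex_hilbert \<Rightarrow>\<^sub>L 'h"
    and M :: "real \<Rightarrow> 'h \<Rightarrow>\<^sub>L 'h"
    and N :: "real \<Rightarrow> 'u \<Rightarrow>\<^sub>L 'u"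
    and PT :: "'h \<Rightarrow>\<^sub>L 'h"
    and P :: "real \<Rightarrow> 'h \<Rightarrow>\<^sub>L 'h"
    and s :: real and x :: 'h
    and u_opt :: "real \<Rightarrow> 'u" and y_opt :: "real \<Rightarrow> 'h"
  assumes "0 < T"
    and "H1 T \<theta> A"
    and "H2 T \<theta> \<rho> \<mu> A" and "\<delta> = \<rho> + \<mu> - 1"
    and "H3 T A E"
    and "H4 T \<delta> A E"
    and "H5 T \<delta> \<alpha> A G"
    and "H6 T \<delta> M N"
    and "H7 T A E G \<alpha> PT"
    and "optimal_pairs_known T A E G \<alpha> M N PT"
    and "riccati_operator T A E G \<alpha> M N PT P" and "P T = PT"
    and "riccati_known T A E G \<alpha> M N PT P"
    and "0 \<le> s" and "s < T"
    and "optimal_control T A E G \<alpha> M N PT s x u_opt"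
    and "y_opt = state A E G \<alpha> s x u_opt"
  shows "continuous_on {s..T}
           (\<lambda>t. if t < T then sqrt_op (P t) (y_opt t)
                else final_value T A E G \<alpha> PT s x u_opt)"
proof -
  interpret riccati_system T \<theta> \<delta> \<alpha> A E G M N PT P
    by unfold_locales (use assms in \<open>auto simp: H2_def H7_def\<close>)
  show ?thesis
    unfolding assms(17) by (rule continuous_on_sqrt_P_state) fact+
qed

end
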